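(* Let $\sigma>0$ and let $(\psi,\vartheta)$ be a $\sigma$-periodic cocycle in a real separable Hilbert space $\mathbb{H}$. Suppose: (i) $P\colon\mathbb{H}\to\mathbb{H}$ is a bounded self-adjoint linear operator and $\mathbb{H}=\mathbb{H}^{+}\oplus\mathbb{H}^{-}$ is an orthogonal direct sum of $P$-invariant subspaces with $P|_{\mathbb{H}^{-}}<0$ and $P|_{\mathbb{H}^{+}}>0$; (ii) $\dim\mathbb{H}^{-}=1$; (iii) with $V(u):=(Pu,u)$ there are numbers $\delta>0$ and $\nu>0$ such that $$e^{2\nu r}V(\psi^{r}(q,u)-\psi^{r}(q,v))-e^{2\nu l}V(\psi^{l}(q,u)-\psi^{l}(q,v))\le-\delta\int_{l}^{r}e^{2\nu s}|\psi^{s}(q,u)-\psi^{s}(q,v)|^{2}ds$$ for all $u,v\in\mathbb{H}$, $q\in\mathcal{Q}$ and $0\le l\le r$; (iv) either $P$ is compact, or there exists $t_{com}>0$ such that the map $\psi^{t_{com}}(q,\cdot)\colon\mathbb{H}\to\mathbb{H}$ is compact for every $q\in\mathcal{Q}$. If a non-empty bounded closed set $\mathcal{S}_0\subset\mathbb{H}$ is a sink for the cocycle $(\psi,\vartheta)$, then there exists a Lyapunov stable $\sigma$-periodic trajectory in $\mathcal{S}_0$ (that is, a Lyapunov stable $\sigma$-periodic trajectory $v^{*}$ with $v^{*}(t)\in\mathcal{S}_0$ for all $t\in\mathbb{R}$).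
   Context: A cocycle $(\psi,\vartheta)$ in $\mathbb{H}$ over a flow $\{\vartheta^t\}_{t\in\mathbb{R}}$ on a metric space $\mathcal{Q}$ is a family of maps $\psi^{t}\colon\mathcal{Q}\times\mathbb{H}\to\mathbb{H}$, $t\ge0$, such that $\psi^{0}(q,u)=u$; $\psi^{t+s}(q,u)=\psi^{t}(\vartheta^{s}(q),\psi^{s}(q,u))$ for all $u,q$ and $t,s\ge0$; and $(t,q,u)\mapsto\psi^{t}(q,u)$ is continuous on $\mathbb{R}_{+}\times\mathcal{Q}\times\mathbb{H}$. It is $\sigma$-periodic if $\mathcal{Q}=\mathbb{R}/\sigma\mathbb{Z}$ and $\vartheta^{t}(\theta)=\theta+t$. $P|_{E}<0$ (resp. $>0$) means $(Pu,u)<0$ (resp. $>0$) for all non-zero $u\in E$. A (possibly nonlinear) compact map sends bounded sets to relatively compact sets. A complete trajectory at $q$ is a continuous map $u\colon\mathbb{R}\to\mathbb{H}$ with $u(t+s)=\psi^{t}(\vartheta^{s}(q),u(s))$ for all $t\ge0$, $s\in\mathbb{R}$; it is a $\sigma$-periodic trajectory if moreover $u(t+\sigma)=u(t)$ for all $t$. A trajectory $v^{*}$ at $q$ is Lyapunov stable if for every $\varepsilon>0$ there is $\eta>0$ such that any $u(t)=\psi^{t}(q,u_0)$ with $|u(0)-v^{*}(0)|<\eta$ satisfies $|u(t)-v^{*}(t)|<\varepsilon$ for all $t\ge0$. A bounded closed subset $\mathcal{S}_0\subset\mathbb{H}$ is a sink if there exists an open set $\mathcal{G}\supset\mathcal{S}_0$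 such that for every $u_0\in\mathcal{G}$ and $q\in\mathcal{Q}$ there exists $T=T(q,u_0)\ge0$ with $\psi^{t}(q,u_0)\in\mathcal{S}_0$ for all $t\ge T$. *)

theory Defs
  imports "HOL-Analysis.Analysis"
begin

section \<open>Flows and cocycles\<close>

definition flow :: "'q set \<Rightarrow> ('q \<Rightarrow> 'q \<Rightarrow> real) \<Rightarrow> (real \<Rightarrow> 'q \<Rightarrow> 'q) \<Rightarrow> bool" where
  "flow Q d \<theta> \<longleftrightarrow>
     Metric_space Q d \<and>
     (\<forall>q\<in>Q. \<theta> 0 q = q) \<and>
     (\<forall>t s. \<forall>q\<in>Q. \<theta> (t + s) q = \<theta> t (\<theta> s q)) \<and>
     continuous_map (prod_topology euclideanreal (Metric_space.mtopology Q d))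
       (Metric_space.mtopology Q d) (\<lambda>(t, q). \<theta> t q)"

text \<open>The value of \<open>\<psi> t q u\<close> is irrelevant for \<open>t < 0\<close> and for \<open>q\<close> outside of \<open>Q\<close>.\<close>

definition cocycle ::
  "'q set \<Rightarrow> ('q \<Rightarrow> 'q \<Rightarrow> real) \<Rightarrow> (real \<Rightarrow> 'q \<Rightarrow> 'q) \<Rightarrow>
   (real \<Rightarrow> 'q \<Rightarrow> 'h \<Rightarrow> 'h::real_normed_vector) \<Rightarrow> bool" where
  "cocycle Q d \<theta> \<psi> \<longleftrightarrow>
     flow Q d \<theta> \<and>
     (\<forall>q\<in>Q. \<forall>u. \<psi> 0 q u = u) \<and>
     (\<forall>t\<ge>0. \<forall>s\<ge>0. \<forall>q\<in>Q. \<forall>u. \<psi> (t + s) q u = \<psi> t (\<theta> s q) (\<psi> s q u)) \<and>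
     continuous_map
       (prod_topology (top_of_set {0..}) (prod_topology (Metric_space.mtopology Q d) euclidean))
       euclidean (\<lambda>(t, q, u). \<psi> t q u)"

text \<open>
  The circle \<open>\<real>/\<sigma>\<int>\<close> is the set of cosets of \<open>\<sigma>\<int>\<close>, with the quotient metric: the distance
  of two cosets is the infimum \<^const>\<open>setdist\<close> of the distances of their representatives.
\<close>

definition circle_point :: "real \<Rightarrow> real \<Rightarrow> real set" where
  "circle_point \<sigma> s = range (\<lambda>k::int. s + of_int k * \<sigma>)"

definition circle :: "real \<Rightarrow> real set set" where
  "circle \<sigma> = range (circle_point \<sigma>)"

definition rotation :: "real \<Rightarrow> real set \<Rightarrow> real set" where
  "rotation t q = (\<lambda>s. s + t) ` q"

definition periodic_cocycle ::
  "real \<Rightarrow> (real \<Rightarrow> real set \<Rightarrow> 'h \<Rightarrow> 'h::real_normed_vector) \<Rightarrow> bool" where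
  "periodic_cocycle \<sigma> \<psi> \<longleftrightarrow> cocycle (circle \<sigma>) setdist rotation \<psi>"

lemma rotation_circle_point: "rotation t (circle_point \<sigma> s) = circle_point \<sigma> (s + t)"
  by (auto simp: rotation_def circle_point_def image_image algebra_simps)

lemma circle_point_eqI:
  assumes "x \<in> circle_point \<sigma> s"
  shows "circle_point \<sigma> x = circle_point \<sigma> s"
proof -
  obtain k :: int where k: "x = s + of_int k * \<sigma>"
    using assms by (auto simp: circle_point_def)
  have "s + of_int j * \<sigma> = x + of_int (j - k) * \<sigma>" "x + of_int j * \<sigma> = s + of_int (j + k) * \<sigma>"
    for j :: int
    by (simp_all add: k algebra_simps)
  then show ?thesis
    unfolding circle_point_def by blast
qed

lemma mem_circle_point: "s \<in> circle_point \<sigma> s"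
proof -
  have "s = s + of_int 0 * \<sigma>" by simp
  then show ?thesis unfolding circle_point_def by blast
qed

lemma circle_point_shift:
  "x \<in> circle_point \<sigma> s \<Longrightarrow> y \<in> circle_point \<sigma> s \<Longrightarrow> z \<in> circle_point \<sigma> r \<Longrightarrow> z + (x - y) \<in> circle_point \<sigma> r"
proof -
  assume "x \<in> circle_point \<sigma> s" "y \<in> circle_point \<sigma> s" "z \<in> circle_point \<sigma> r"
  then obtain i j k :: int
    where "x = s + of_int i * \<sigma>" "y = s + of_int j * \<sigma>" "z = r + of_int k * \<sigma>"
    by (auto simp: circle_point_def)
  then have "z + (x - y) = r + of_int (k + i - j) * \<sigma>"
    by (simp add: algebra_simps)
  then show ?thesis unfolding circle_point_def by blast
qed

lemma closed_circle_point: "closed (circle_point \<sigma> s)"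
proof -
  have "circle_point \<sigma> s = (+) s ` ((*\<^sub>R) \<sigma> ` \<int>)"
    by (auto simp: circle_point_def Ints_def image_image mult.commute)
  then show ?thesis
    using closed_translation[OF closed_scaling[OF closed_Ints]] by metis
qed

lemma setdist_circle_point: "setdist (circle_point \<sigma> s) (circle_point \<sigma> r) = infdist s (circle_point \<sigma> r)"
proof (rule antisym)
  show "setdist (circle_point \<sigma> s) (circle_point \<sigma> r) \<le> infdist s (circle_point \<sigma> r)"
    by (simp add: infdist_eq_setdist setdist_le_sing mem_circle_point)
  show "infdist s (circle_point \<sigma> r) \<le> setdist (circle_point \<sigma> s) (circle_point \<sigma> r)"
  proof (rule le_setdistI)
    fix x y assume x: "x \<in> circle_point \<sigma> s" and y: "y \<in> circle_point \<sigma> r"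
    have "y + (s - x) \<in> circle_point \<sigma> r"
      using circle_point_shift[OF mem_circle_point x y] .
    then have "infdist s (circle_point \<sigma> r) \<le> dist s (y + (s - x))"
      by (rule infdist_le)
    also have "\<dots> = dist x y"
      by (simp add: dist_real_def)
    finally show "infdist s (circle_point \<sigma> r) \<le> dist x y" .
  qed (use mem_circle_point in blast)+
qed

lemma setdist_circle_le: "setdist (circle_point \<sigma> s) (circle_point \<sigma> r) \<le> \<bar>s - r\<bar>"
  by (metis dist_real_def mem_circle_point setdist_le_dist)

lemma Metric_space_circle: "Metric_space (circle \<sigma>) setdist"
proof
  show "0 \<le> setdist x y" "setdist x y = setdist y x" for x y :: "real set"
    by (simp_all add: setdist_sym)
next
  fix p q assume "p \<in> circle \<sigma>" "q \<in> circle \<sigma>"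
  then obtain s r where sr: "p = circle_point \<sigma> s" "q = circle_point \<sigma> r"
    by (auto simp: circle_def)
  have "setdist p q = 0 \<longleftrightarrow> s \<in> circle_point \<sigma> r"
    using in_closed_iff_infdist_zero[OF closed_circle_point, of \<sigma> r s] mem_circle_point
    unfolding sr setdist_circle_point by blast
  also have "\<dots> \<longleftrightarrow> p = q"
    using circle_point_eqI mem_circle_point sr by metis
  finally show "setdist p q = 0 \<longleftrightarrow> p = q" .
next
  fix p q w assume "p \<in> circle \<sigma>" "q \<in> circle \<sigma>" "w \<in> circle \<sigma>"
  then obtain s r v where sr: "p = circle_point \<sigma> s" "q = circle_point \<sigma> r" "w = circle_point \<sigma> v"
    by (auto simp: circle_def)
  show "setdist p w \<le> setdist p q + setdist q w"
    unfolding sr by (metis infdist_triangle setdist_circle_point setdist_sym add.commute dist_commute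
        infdist_eq_setdist setdist_triangle)
qed

lemma flow_rotation: "flow (circle \<sigma>) setdist rotation"
proof -
  interpret Metric_space "circle \<sigma>" setdist by (rule Metric_space_circle)
  have est: "setdist (rotation t p) (rotation t' q) \<le> \<bar>t - t'\<bar> + setdist p q"
    if pq: "p \<in> circle \<sigma>" "q \<in> circle \<sigma>" for t t' p q
  proof -
    obtain s r where sr: "p = circle_point \<sigma> s" "q = circle_point \<sigma> r"
      using pq by (auto simp: circle_def)
    have "setdist (rotation t p) (rotation t' q) - \<bar>t - t'\<bar> \<le> setdist p q"
    proof (rule le_setdistI)
      fix x y assume x: "x \<in> p" and y: "y \<in> q"
      have "setdist (rotation t p) (rotation t' q) \<le> dist (x + t) (y + t')"
        using x y by (intro setdist_le_dist) (auto simp: rotation_def)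
      also have "\<dots> \<le> \<bar>t - t'\<bar> + dist x y"
        unfolding dist_real_def by linarith
      finally show "setdist (rotation t p) (rotation t' q) - \<bar>t - t'\<bar> \<le> dist x y" by simp
    qed (use sr mem_circle_point in blast)+
    then show ?thesis by simp
  qed
  have cl: "rotation t q \<in> circle \<sigma>" if "q \<in> circle \<sigma>" for t q
    using that by (auto simp: circle_def rotation_circle_point)
  have "continuous_map (prod_topology euclideanreal mtopology) mtopology (\<lambda>(t, q). rotation t q)"
    unfolding continuous_map_to_metric
  proof (intro ballI allI impI)
    fix z :: "real \<times> real set" and e :: real
    assume z: "z \<in> topspace (prod_topology euclideanreal mtopology)" and e: "0 < e"
    obtain t q where tq: "z = (t, q)" "q \<in> circle \<sigma>"
      using z by auto
    have "openin (prod_topology euclideanreal mtopology) (ball t (e/2) \<times> mball q (e/2))"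
      by (simp add: openin_prod_Times_iff)
    moreover have "z \<in> ball t (e/2) \<times> mball q (e/2)"
      using tq e by simp
    moreover have "(case y of (t, q) \<Rightarrow> rotation t q) \<in> mball (case z of (t, q) \<Rightarrow> rotation t q) e"
      if *: "y \<in> ball t (e/2) \<times> mball q (e/2)" for y
    proof -
      obtain t' q' where y: "y = (t', q')" "\<bar>t - t'\<bar> < e/2" "q' \<in> circle \<sigma>" "setdist q q' < e/2"
        using * by (auto simp: dist_real_def)
      show ?thesis
        using est[of q q' t t'] y tq cl by simp
    qed
    ultimately show "\<exists>U. openin (prod_topology euclideanreal mtopology) U \<and> z \<in> U \<and>
        (\<forall>y\<in>U. (case y of (t, q) \<Rightarrow> rotation t q) \<in> mball (case z of (t, q) \<Rightarrow> rotation t q) e)"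
      by blast
  qed
  moreover have "rotation 0 q = q" "rotation (t + s) q = rotation t (rotation s q)" for t s q
    by (simp_all add: rotation_def image_image algebra_simps)
  ultimately show ?thesis
    unfolding flow_def using Metric_space_axioms by blast
qed


section \<open>Operators on a Hilbert space\<close>

definition self_adjoint :: "('h::real_inner \<Rightarrow> 'h) \<Rightarrow> bool" where
  "self_adjoint P \<longleftrightarrow> (\<forall>x y. P x \<bullet> y = x \<bullet> P y)"

text \<open>Orthogonality makes the sum direct and both summands closed.\<close>

definition orthogonal_direct_sum :: "'h::real_inner set \<Rightarrow> 'h set \<Rightarrow> bool" where
  "orthogonal_direct_sum E F \<longleftrightarrow>
     subspace E \<and> subspace F \<and>
     (\<forall>x\<in>E. \<forall>y\<in>F. orthogonal x y) \<and>
     {x + y | x y. x \<in> E \<and> y \<in> F} = UNIV"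

definition quadratic_form :: "('h::real_inner \<Rightarrow> 'h) \<Rightarrow> 'h \<Rightarrow> real" where
  "quadratic_form P u = P u \<bullet> u"

definition positive_on :: "('h::real_inner \<Rightarrow> 'h) \<Rightarrow> 'h set \<Rightarrow> bool" where
  "positive_on P E \<longleftrightarrow> (\<forall>u\<in>E. u \<noteq> 0 \<longrightarrow> P u \<bullet> u > 0)"

definition negative_on :: "('h::real_inner \<Rightarrow> 'h) \<Rightarrow> 'h set \<Rightarrow> bool" where
  "negative_on P E \<longleftrightarrow> (\<forall>u\<in>E. u \<noteq> 0 \<longrightarrow> P u \<bullet> u < 0)"

text \<open>The map is not assumed to be linear.\<close>

definition compact_map :: "('h::real_normed_vector \<Rightarrow> 'h) \<Rightarrow> bool" where
  "compact_map f \<longleftrightarrow> (\<forall>B. bounded B \<longrightarrow> compact (closure (f ` B)))"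


section \<open>Trajectories, stability and sinks\<close>

definition complete_trajectory ::
  "(real \<Rightarrow> 'q \<Rightarrow> 'q) \<Rightarrow> (real \<Rightarrow> 'q \<Rightarrow> 'h \<Rightarrow> 'h::real_normed_vector) \<Rightarrow>
   'q \<Rightarrow> (real \<Rightarrow> 'h) \<Rightarrow> bool" where
  "complete_trajectory \<theta> \<psi> q u \<longleftrightarrow>
     continuous_on UNIV u \<and> (\<forall>t\<ge>0. \<forall>s. u (t + s) = \<psi> t (\<theta> s q) (u s))"

definition periodic_trajectory ::
  "real \<Rightarrow> (real \<Rightarrow> 'q \<Rightarrow> 'q) \<Rightarrow> (real \<Rightarrow> 'q \<Rightarrow> 'h \<Rightarrow> 'h::real_normed_vector) \<Rightarrow>
   'q \<Rightarrow> (real \<Rightarrow> 'h) \<Rightarrow> bool" where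
  "periodic_trajectory \<sigma> \<theta> \<psi> q u \<longleftrightarrow>
     complete_trajectory \<theta> \<psi> q u \<and> (\<forall>t. u (t + \<sigma>) = u t)"

definition lyapunov_stable ::
  "(real \<Rightarrow> 'q \<Rightarrow> 'h \<Rightarrow> 'h::real_normed_vector) \<Rightarrow> 'q \<Rightarrow> (real \<Rightarrow> 'h) \<Rightarrow> bool" where
  "lyapunov_stable \<psi> q v \<longleftrightarrow>
     (\<forall>\<epsilon>>0. \<exists>\<eta>>0. \<forall>u\<^sub>0. norm (\<psi> 0 q u\<^sub>0 - v 0) < \<eta> \<longrightarrow>
        (\<forall>t\<ge>0. norm (\<psi> t q u\<^sub>0 - v t) < \<epsilon>))"

definition sink ::
  "'q set \<Rightarrow> (real \<Rightarrow> 'q \<Rightarrow> 'h \<Rightarrow> 'h::real_normed_vector) \<Rightarrow> 'h set \<Rightarrow> bool" where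
  "sink Q \<psi> S\<^sub>0 \<longleftrightarrow>
     bounded S\<^sub>0 \<and> closed S\<^sub>0 \<and>
     (\<exists>G. open G \<and> S\<^sub>0 \<subseteq> G \<and>
        (\<forall>u\<^sub>0\<in>G. \<forall>q\<in>Q. \<exists>T\<ge>0. \<forall>t\<ge>T. \<psi> t q u\<^sub>0 \<in> S\<^sub>0))"

end

theory Submission
  imports Defs "HOL-Library.Diagonal_Subsequence"
begin

text \<open>
  Put \<open>V u = (Pu, u)\<close> and let \<open>e\<close> span the negative subspace. Two bounded complete trajectories satisfy \<open>V \<le> 0\<close> on
  their difference, since \<open>exp (2 \<nu> t) V\<close> decreases and tends to zero backwards in time. Hence the
  projection to \<open>e\<close> orders the bounded complete trajectories linearly, and the period map \<open>T\<close>
  preserves this order. Every complete orbit of \<open>T\<close> in the sink is then monotone and connects two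
  fixed points. An extremal choice yields a fixed point without outgoing connections. It is stable:
  otherwise points escaping from it produce, by asymptotic compactness, a complete orbit nearby, and
  comparing the escaping points with this orbit contradicts its monotonicity.
\<close>

section \<open>Order-preserving maps with an invariant cone\<close>

text \<open>The cone \<open>V \<le> 0\<close> is invariant, but two arbitrary points need not differ
  by an element of it: \<open>T\<close> preserves no order on the whole space, and a point near a
  fixed point \<open>p\<close> need not be comparable with \<open>p\<close>. Comparisons are
  therefore made with complete orbits other than \<open>p\<close>. For these the strict contraction
  of \<open>V\<close> gives \<open>V < 0\<close> and not merely \<open>V \<le> 0\<close>; this is an
  open condition, so points close to \<open>p\<close> are still comparable with the given orbit. The
  sink brings a second difficulty. Its time of attraction depends on the initial point, so there is
  no uniform absorption, and limits along unbounded times have to come from histories that stay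
  bounded up to their last step. Finally, fixed points may accumulate, so stability cannot rest on
  isolating one of them. What contradicts escape is an immediate neighbour of \<open>p\<close> in
  the order: there is at most one on each side, and it has a positive distance to
  \<open>p\<close>.\<close>

lemma eventually_less_of_limits:
  assumes "(f \<longlongrightarrow> a) F" "(g \<longlongrightarrow> b) F" "(a::real) < b"
  shows "\<forall>\<^sub>F x in F. f x < g x"
proof -
  obtain c where "a < c" "c < b" using dense[OF assms(3)] by blast
  then show ?thesis
    using order_tendstoD(2)[OF assms(1), of c] order_tendstoD(1)[OF assms(2), of c]
    by (auto elim: eventually_elim2)
qed

text \<open>The sets \<open>B R\<close> replace norm balls, both in \<open>T_compact\<close> and in
  the boundedness of orbits: for the period map they bound the trajectory over a whole period, while
  a continuous map of an infinite-dimensional space may be unbounded on a norm ball.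
  \<open>T_compact\<close> asks for boundedness only before the final step, because escaping points
  are controlled just until they leave a small ball.\<close>

locale cone_system =
  fixes T :: "'h::real_normed_vector \<Rightarrow> 'h" and V \<phi> :: "'h \<Rightarrow> real" and \<kappa> C :: real
    and B :: "real \<Rightarrow> 'h set" and G S :: "'h set"
  assumes T_cont: "continuous_on UNIV T"
    and \<phi>_lin: "bounded_linear \<phi>"
    and V_cont: "continuous_on UNIV V"
    and V_minus: "V (- x) = V x"
    and V_bound: "\<bar>V x\<bar> \<le> C * (norm x)\<^sup>2"
    and V_ker: "V x \<le> 0 \<Longrightarrow> \<phi> x = 0 \<Longrightarrow> x = 0"
    and \<kappa>_gt1: "1 < \<kappa>"
    and V_contract: "u \<noteq> v \<Longrightarrow> \<kappa> * V (T u - T v) < V (u - v)"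
    and T_mono: "V (u - v) \<le> 0 \<Longrightarrow> \<phi> u < \<phi> v \<Longrightarrow> \<phi> (T u) < \<phi> (T v)"
    and B_mono: "R \<le> R' \<Longrightarrow> B R \<subseteq> B R'"
    and B_closed: "closed (B R)"
    and B_norm: "x \<in> B R \<Longrightarrow> norm x \<le> R"
    and B_local: "\<exists>R e. 0 < e \<and> cball x e \<subseteq> B R"
    and T_compact: "filterlim n at_top sequentially \<Longrightarrow> (\<And>k j. j < n k \<Longrightarrow> (T ^^ j) (z k) \<in> B R) \<Longrightarrow>
        \<exists>r l. strict_mono r \<and> (\<lambda>k. (T ^^ n (r k)) (z (r k))) \<longlonglongrightarrow> l"
    and S_closed: "closed S" and S_G: "S \<subseteq> G" and S_B: "\<exists>R. S \<subseteq> B R"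
    and G_open: "open G" and G_ne: "G \<noteq> {}"
    and G_attr: "u \<in> G \<Longrightarrow> \<forall>\<^sub>F n in sequentially. (T ^^ n) u \<in> S"
begin

lemma V_diff_commute: "V (u - v) = V (v - u)"
  using V_minus[of "v - u"] by simp

lemma V_zero: "V 0 = 0"
  using V_bound[of 0] by simp

lemma V_iter: "\<kappa> ^ n * V ((T ^^ n) u - (T ^^ n) v) \<le> V (u - v)"
proof (induction n)
  case (Suc n)
  have "\<kappa> * V (T x - T y) \<le> V (x - y)" for x y
    using V_contract[of x y] by (cases "x = y") (auto simp: V_zero)
  then have "\<kappa> ^ n * (\<kappa> * V ((T ^^ Suc n) u - (T ^^ Suc n) v)) \<le> \<kappa> ^ n * V ((T ^^ n) u - (T ^^ n) v)"
    using \<kappa>_gt1 by (intro mult_left_mono) auto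
  then show ?case using Suc by (simp add: mult_ac)
qed simp

lemma cone_T: "V (T u - T v) \<le> 0" if "V (u - v) \<le> 0"
proof -
  have "\<kappa> * V (T u - T v) \<le> 0"
    using V_iter[of 1 u v] that by simp
  then show ?thesis using \<kappa>_gt1 by (simp add: mult_le_0_iff)
qed

lemma T_iter_mono:
  "V (u - v) \<le> 0 \<Longrightarrow> \<phi> u < \<phi> v \<Longrightarrow> V ((T ^^ n) u - (T ^^ n) v) \<le> 0 \<and> \<phi> ((T ^^ n) u) < \<phi> ((T ^^ n) v)"
  by (induction n) (auto simp: cone_T T_mono)

lemma cone_inj: "V (u - v) \<le> 0 \<Longrightarrow> \<phi> u = \<phi> v \<Longrightarrow> u = v"
  using V_ker[of "u - v"] bounded_linear.linear[OF \<phi>_lin] by (simp add: linear_diff)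

lemma \<phi>_cont: "(f \<longlongrightarrow> l) F \<Longrightarrow> ((\<lambda>x. \<phi> (f x)) \<longlongrightarrow> \<phi> l) F"
  by (rule bounded_linear.tendsto[OF \<phi>_lin])

lemma T_tendsto: "(f \<longlongrightarrow> l) F \<Longrightarrow> ((\<lambda>x. T (f x)) \<longlongrightarrow> T l) F"
  using T_cont by (auto intro: continuous_on_tendsto_compose)

lemma V_tendsto: "(f \<longlongrightarrow> l) F \<Longrightarrow> ((\<lambda>x. V (f x)) \<longlongrightarrow> V l) F"
  using V_cont by (auto intro: continuous_on_tendsto_compose)

lemma T_iter_tendsto: "(f \<longlongrightarrow> l) F \<Longrightarrow> ((\<lambda>x. (T ^^ n) (f x)) \<longlongrightarrow> (T ^^ n) l) F"
  by (induction n) (auto intro: T_tendsto)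

section \<open>Bounded complete orbits: their order, monotonicity and limits\<close>

definition orbit :: "(int \<Rightarrow> 'h) \<Rightarrow> bool" where
  "orbit w \<longleftrightarrow> (\<forall>i. w (i + 1) = T (w i)) \<and> (\<exists>R. \<forall>i. w i \<in> B R)"

lemma orbit_iter: "orbit w \<Longrightarrow> w (i + int n) = (T ^^ n) (w i)"
proof (induction n)
  case (Suc n)
  have "w (i + int (Suc n)) = w ((i + int n) + 1)" by (simp add: algebra_simps)
  then show ?case using Suc by (simp add: orbit_def)
qed simp

lemma orbit_iter': "orbit w \<Longrightarrow> i \<le> j \<Longrightarrow> w j = (T ^^ nat (j - i)) (w i)"
  using orbit_iter[of w i "nat (j - i)"] by simp

lemma orbit_shift: "orbit w \<Longrightarrow> orbit (\<lambda>i. w (i + k))"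
  unfolding orbit_def add.assoc add.commute[of 1 k] unfolding add.assoc[symmetric] by blast

lemma orbit_const: "T p = p \<Longrightarrow> orbit (\<lambda>_. p)"
  using B_local[of p] by (force simp: orbit_def)

lemma orbit_common_bound:
  assumes "orbit w" "orbit w'"
  obtains R where "0 \<le> R" "\<And>i. norm (w i - w' i) \<le> R"
proof -
  obtain R R' where "\<And>i. norm (w i) \<le> R" "\<And>i. norm (w' i) \<le> R'"
    using assms B_norm unfolding orbit_def by meson
  then have "norm (w i - w' i) \<le> R + R'" for i
    by (meson add_mono norm_triangle_le_diff)
  moreover from this[of 0] have "0 \<le> R + R'" by (meson norm_ge_zero order_trans)
  ultimately show ?thesis using that by blast
qed

text \<open>Going back \<open>n\<close> steps gains the factor \<open>\<kappa> ^ n\<close>, whereas \<open>V\<close> stays bounded along the two orbits.\<close>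

lemma orbit_cone: "V (w i - w' i) \<le> 0" if w: "orbit w" "orbit w'"
proof (rule field_le_epsilon)
  fix e :: real assume "0 < e"
  obtain R where R: "\<And>i. norm (w i - w' i) \<le> R" "0 \<le> R"
    using orbit_common_bound[OF w] by metis
  have bound: "V (w j - w' j) \<le> \<bar>C\<bar> * R\<^sup>2" for j
  proof -
    have "V (w j - w' j) \<le> C * (norm (w j - w' j))\<^sup>2"
      using V_bound[of "w j - w' j"] by simp
    also have "\<dots> \<le> \<bar>C\<bar> * R\<^sup>2"
      using R by (intro mult_mono power_mono) auto
    finally show ?thesis .
  qed
  obtain n where n: "\<bar>C\<bar> * R\<^sup>2 / e < \<kappa> ^ n"
    using real_arch_pow[OF \<kappa>_gt1] by blast
  have "\<kappa> ^ n * V (w i - w' i) \<le> V (w (i - int n) - w' (i - int n))"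
    using V_iter[of n "w (i - int n)" "w' (i - int n)"] orbit_iter[of w "i - int n" n]
      orbit_iter[of w' "i - int n" n] w by simp
  also have "\<dots> \<le> \<kappa> ^ n * e"
    using bound[of "i - int n"] n \<open>0 < e\<close> by (simp add: field_simps)
  finally show "V (w i - w' i) \<le> 0 + e"
    using \<kappa>_gt1 by simp
qed

lemma orbit_inj: "orbit w \<Longrightarrow> orbit w' \<Longrightarrow> \<phi> (w i) = \<phi> (w' i) \<Longrightarrow> w i = w' i"
  using cone_inj orbit_cone by blast

lemma orbit_eq_forward: "orbit w \<Longrightarrow> orbit w' \<Longrightarrow> w i = w' i \<Longrightarrow> i \<le> j \<Longrightarrow> w j = w' j"
  using orbit_iter'[of w i j] orbit_iter'[of w' i j] by simp

lemma orbit_less_forward: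
  assumes "orbit w" "orbit w'" "\<phi> (w i) < \<phi> (w' i)" "i \<le> j"
  shows "\<phi> (w j) < \<phi> (w' j)"
  using T_iter_mono[OF orbit_cone[OF assms(1,2)] assms(3)] orbit_iter'[of w i j] orbit_iter'[of w' i j]
    assms by simp

text \<open>\<open>T\<close> is monotone forwards only and may fail to be injective; but equality or
  the reversed order at an earlier time \<open>j\<close> would be carried forward to
  \<open>i\<close>.\<close>

lemma orbit_less:
  assumes w: "orbit w" "orbit w'" and less: "\<phi> (w i) < \<phi> (w' i)"
  shows "\<phi> (w j) < \<phi> (w' j)"
proof (cases "i \<le> j")
  case False
  then have ji: "j \<le> i" by simp
  show ?thesis
  proof (rule linorder_cases[of "\<phi> (w j)" "\<phi> (w' j)"])
    assume "\<phi> (w j) = \<phi> (w' j)"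
    then show ?thesis
      using orbit_eq_forward[OF w orbit_inj[OF w] ji] less by simp
  next
    assume "\<phi> (w' j) < \<phi> (w j)"
    then show ?thesis
      using orbit_less_forward[OF w(2,1) _ ji] less by force
  qed
qed (use orbit_less_forward[OF assms] in simp)

text \<open>The orbits already differ at \<open>i - 1\<close>, so the strict contraction applies to
  the last step. The strict sign persists under small perturbations of the two points.\<close>

lemma orbit_cone_strict:
  assumes w: "orbit w" "orbit w'" and less: "\<phi> (w i) < \<phi> (w' i)"
  shows "V (w i - w' i) < 0"
proof -
  have "w (i - 1) \<noteq> w' (i - 1)"
    using orbit_less[OF assms, of "i - 1"] by auto
  moreover have "w i = T (w (i - 1))" "w' i = T (w' (i - 1))"
    using w orbit_iter[of _ "i - 1" 1] by auto
  ultimately have "\<kappa> * V (w i - w' i) < V (w (i - 1) - w' (i - 1))"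
    using V_contract by simp
  also have "\<dots> \<le> 0" by (rule orbit_cone[OF w])
  finally show ?thesis using \<kappa>_gt1 by (simp add: mult_less_0_iff)
qed

lemma orbit_self_cone: "orbit w \<Longrightarrow> V (w i - w j) \<le> 0"
  using orbit_cone[OF _ orbit_shift, of w w i "j - i"] by simp

text \<open>The recursion alone does not force the past of a fixed point, as \<open>T\<close> may
  fail to be injective; comparison with the constant orbit excludes every other bounded
  past.\<close>

lemma orbit_fixed: "orbit w \<Longrightarrow> w 1 = w 0 \<Longrightarrow> w i = w 0"
proof -
  assume w: "orbit w" and eq: "w 1 = w 0"
  have sh: "orbit (\<lambda>j. w (j + k))" for k using orbit_shift[OF w] .
  have T0: "T (w 0) = w 0" using w eq by (auto simp: orbit_def dest: spec[of _ 0])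
  have "orbit (\<lambda>_. w 0)" by (rule orbit_const[OF T0])
  then have "\<phi> (w i) = \<phi> (w 0)"
    using orbit_less[OF w, of "\<lambda>_. w 0" i 0] orbit_less[OF _ w, of "\<lambda>_. w 0" i 0]
    by (meson less_irrefl linorder_less_linear)
  then show "w i = w 0"
    using orbit_inj[OF w orbit_const[OF T0]] by simp
qed

lemma orbit_up: "orbit w \<Longrightarrow> \<phi> (w 0) < \<phi> (w 1) \<Longrightarrow> i < j \<Longrightarrow> \<phi> (w i) < \<phi> (w j)"
proof -
  assume w: "orbit w" and up: "\<phi> (w 0) < \<phi> (w 1)" and ij: "i < j"
  have "\<phi> (w i) < \<phi> (w (i + 1))" for i
    using orbit_less[OF w orbit_shift[OF w, of 1], of 0] up by simp
  with ij show ?thesis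
    by (induction rule: int_gr_induct) (blast intro: less_trans)+
qed

lemma orbit_down: "orbit w \<Longrightarrow> \<phi> (w 1) < \<phi> (w 0) \<Longrightarrow> i < j \<Longrightarrow> \<phi> (w j) < \<phi> (w i)"
proof -
  assume w: "orbit w" and up: "\<phi> (w 1) < \<phi> (w 0)" and ij: "i < j"
  have "\<phi> (w (i + 1)) < \<phi> (w i)" for i
    using orbit_less[OF orbit_shift[OF w, of 1] w, of 0] up by simp
  with ij show ?thesis
    by (induction rule: int_gr_induct) (blast intro: less_trans)+
qed

text \<open>The sign \<open>s\<close> is the direction of time, so that forward and backward limits
  share one argument.\<close>

lemma orbit_monoseq:
  assumes w: "orbit w" and s: "s = 1 \<or> s = -1"
  shows "monoseq (\<lambda>n. \<phi> (w (s * int n)))"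
proof (rule linorder_cases[of "\<phi> (w 0)" "\<phi> (w 1)"])
  assume "\<phi> (w 0) < \<phi> (w 1)"
  then have "\<phi> (w i) \<le> \<phi> (w j)" if "i \<le> j" for i j
    using orbit_up[OF w, of i j] that by (cases "i = j") auto
  then show ?thesis using s by (auto simp: monoseq_def)
next
  assume "\<phi> (w 1) < \<phi> (w 0)"
  then have "\<phi> (w j) \<le> \<phi> (w i)" if "i \<le> j" for i j
    using orbit_down[OF w, of i j] that by (cases "i = j") auto
  then show ?thesis using s by (auto simp: monoseq_def)
next
  assume "\<phi> (w 0) = \<phi> (w 1)"
  then have "w 1 = w 0"
    using orbit_inj[OF w orbit_shift[OF w, of 1], of 0] by simp
  then have "w i = w 0" for i by (rule orbit_fixed[OF w])
  then have "w (s * int n) = w 0" for n by blast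
  then show ?thesis by (simp add: monoseq_def)
qed

text \<open>Monotonicity makes the \<open>\<phi>\<close>-values converge, and compactness makes the
  points converge along a subsequence to some \<open>p\<close>. One step of \<open>T\<close> does
  not change the limit of the \<open>\<phi>\<close>-values, and the cone condition between
  consecutive points passes to the limit; as \<open>\<phi>\<close> is injective on the cone,
  \<open>T p = p\<close>.\<close>

lemma orbit_limit:
  assumes w: "orbit w" and s: "s = 1 \<or> s = -1"
  obtains p r where "T p = p" "(\<lambda>n. \<phi> (w (s * int n))) \<longlonglongrightarrow> \<phi> p" "strict_mono r"
    "(\<lambda>n. w (s * int (r n))) \<longlonglongrightarrow> p"
proof -
  obtain R where R: "\<And>i. w i \<in> B R" using w by (auto simp: orbit_def)
  have fl: "filterlim (\<lambda>k::nat. k) at_top sequentially" by (rule filterlim_ident)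
  \<comment> \<open>The starting points lie \<open>k\<close> steps before
    \<open>w (s * int k)\<close>: always at index 0 for \<open>s = 1\<close>, and at index
    \<open>- 2 * int k\<close> for \<open>s = -1\<close>.\<close>
  have "\<exists>r l. strict_mono r \<and> (\<lambda>k. (T ^^ r k) (w (s * int (r k) - int (r k)))) \<longlonglongrightarrow> l"
    by (rule T_compact[where z = "\<lambda>k. w (s * int k - int k)", OF fl])
      (use orbit_iter[OF w, symmetric] R in auto)
  then obtain r p where r: "strict_mono r" and lim: "(\<lambda>k. w (s * int (r k))) \<longlonglongrightarrow> p"
    using orbit_iter[OF w, symmetric] by auto
  have "\<bar>\<phi> (w i)\<bar> \<le> onorm \<phi> * R" for i
    using onorm[OF \<phi>_lin, of "w i"] B_norm[OF R, of i] mult_left_mono[OF _ onorm_pos_le[OF \<phi>_lin]]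
    by (metis order_trans real_norm_def)
  then have "Bseq (\<lambda>n. \<phi> (w (s * int n)))"
    by (intro BseqI'[of _ "onorm \<phi> * R"]) simp
  then have "convergent (\<lambda>n. \<phi> (w (s * int n)))"
    using Bseq_monoseq_convergent orbit_monoseq[OF w s] by blast
  then obtain c where c: "(\<lambda>n. \<phi> (w (s * int n))) \<longlonglongrightarrow> c"
    by (auto simp: convergent_def)
  have "(\<lambda>k. \<phi> (w (s * int (r k)))) \<longlonglongrightarrow> c"
    using LIMSEQ_subseq_LIMSEQ[OF c r] by (simp add: o_def)
  then have cp: "c = \<phi> p"
    using LIMSEQ_unique \<phi>_cont[OF lim] by blast
  have wT: "T (w i) = w (i + 1)" for i using w by (simp add: orbit_def)
  have "(\<lambda>k. V (w (s * int (r k) + 1) - w (s * int (r k)))) \<longlonglongrightarrow> V (T p - p)"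
    using V_tendsto[OF tendsto_diff[OF T_tendsto[OF lim] lim]] by (simp add: wT)
  then have VT: "V (T p - p) \<le> 0"
    by (rule LIMSEQ_le_const2) (use orbit_self_cone[OF w] in blast)
  have "(\<lambda>n. \<phi> (w (s * int n + 1))) \<longlonglongrightarrow> c"
  proof (cases "s = 1")
    case True
    then show ?thesis using LIMSEQ_Suc[OF c] by (simp add: algebra_simps)
  next
    case False
    \<comment> \<open>For \<open>s = -1\<close> the added 1 cancels the passage from
      \<open>n\<close> to \<open>Suc n\<close>, which leaves the original sequence.\<close>
    then have "(\<lambda>n. \<phi> (w (s * int (Suc n) + 1))) \<longlonglongrightarrow> c"
      using s c by simp
    then show ?thesis by (rule LIMSEQ_imp_Suc)
  qed
  then have "(\<lambda>k. \<phi> (w (s * int (r k) + 1))) \<longlonglongrightarrow> c"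
    using LIMSEQ_subseq_LIMSEQ[OF _ r] by (fastforce simp: o_def)
  then have "\<phi> (T p) = c"
    using LIMSEQ_unique \<phi>_cont[OF T_tendsto[OF lim]] by (simp add: wT)
  then have "T p = p" using cone_inj[OF VT] cp by simp
  then show ?thesis using that c cp r lim by blast
qed

section \<open>Complete orbits as limits of long histories\<close>

lemma G_forward_bounded:
  assumes "u \<in> G"
  obtains R where "\<And>n. (T ^^ n) u \<in> B R"
proof -
  obtain N where N: "\<And>n. N \<le> n \<Longrightarrow> (T ^^ n) u \<in> S"
    using G_attr[OF assms] by (auto simp: eventually_sequentially)
  obtain R0 where R0: "S \<subseteq> B R0" using S_B by blast
  have "\<exists>R. x \<in> B R" for x using B_local[of x] by (metis centre_in_cball less_imp_le subsetD)
  then obtain \<rho> where \<rho>: "\<And>x. x \<in> B (\<rho> x)" by metis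
  define R where "R = Max (insert R0 ((\<lambda>n. \<rho> ((T ^^ n) u)) ` {..<N}))"
  have "(T ^^ n) u \<in> B R" for n
  proof (cases "n < N")
    case True
    then have "\<rho> ((T ^^ n) u) \<le> R" unfolding R_def by (intro Max_ge) auto
    then show ?thesis using \<rho> B_mono by blast
  next
    case False
    have "R0 \<le> R" unfolding R_def by (intro Max_ge) auto
    then show ?thesis using False N R0 B_mono by (metis not_less subsetD)
  qed
  then show ?thesis using that by blast
qed

text \<open>Longer and longer histories yield one solution on all integers that passes at index 0
  through the limit of the end points. Compactness applies to the states \<open>j\<close> steps
  before the end for each \<open>j\<close>, and a diagonal subsequence serves all \<open>j\<close>
  at once. The end points need not lie in \<open>B R\<close>, whence the bound at negative indices
  only.\<close>

lemma backward_limit: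
  assumes n: "filterlim n at_top sequentially" and z: "\<And>k j. j < n k \<Longrightarrow> (T ^^ j) (z k) \<in> B R"
  obtains r w where "strict_mono r" "\<And>i. w (i + 1) = T (w i)" "\<And>i. i < 0 \<Longrightarrow> w i \<in> B R"
    "\<And>j. (\<lambda>k. (T ^^ (n (r k) - j)) (z (r k))) \<longlonglongrightarrow> w (- int j)"
proof -
  define P where "P j s \<longleftrightarrow> convergent (\<lambda>k. (T ^^ (n (s k) - j)) (z (s k)))" for j s
  interpret subseqs P
  proof
    fix j and s :: "nat \<Rightarrow> nat" assume s: "strict_mono s"
    have 1: "filterlim (\<lambda>k. n (s k) - j) at_top sequentially"
      by (rule filterlim_compose[OF filterlim_minus_const_nat_at_top
            filterlim_compose[OF n filterlim_subseq[OF s]]])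
    have "\<exists>r l. strict_mono r \<and> (\<lambda>k. (T ^^ (n (s (r k)) - j)) (z (s (r k)))) \<longlonglongrightarrow> l"
      by (rule T_compact[OF 1, of _ R]) (use z in auto)
    then show "\<exists>r. strict_mono r \<and> P j (s \<circ> r)"
      unfolding P_def convergent_def o_def by blast
  qed
  \<comment> \<open>From index \<open>Suc j\<close> on, the diagonal sequence refines a sequence for
    which \<open>P j\<close> was arranged.\<close>
  have "P j (diagseq \<circ> (+) (Suc j))" for j
  proof (rule diagseq_holds)
    fix r s m assume r: "strict_mono (r::nat\<Rightarrow>nat)" and "P m s"
    then obtain l where "(\<lambda>k. (T ^^ (n (s k) - m)) (z (s k))) \<longlonglongrightarrow> l"
      by (auto simp: P_def convergent_def)
    from LIMSEQ_subseq_LIMSEQ[OF this r] show "P m (s \<circ> r)"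
      by (auto simp: P_def convergent_def o_def)
  qed
  then have "convergent (\<lambda>k. (T ^^ (n (diagseq k) - j)) (z (diagseq k)))" for j
    using convergent_ignore_initial_segment[of "\<lambda>k. (T ^^ (n (diagseq k) - j)) (z (diagseq k))" "Suc j"]
    unfolding P_def o_def add.commute[of _ "Suc j"] by simp
  then obtain y where y: "\<And>j. (\<lambda>k. (T ^^ (n (diagseq k) - j)) (z (diagseq k))) \<longlonglongrightarrow> y j"
    unfolding convergent_def by metis
  \<comment> \<open>Natural subtraction truncates \<open>n (diagseq k) - j\<close>, but for fixed
    \<open>j\<close> only at finitely many \<open>k\<close>.\<close>
  have ev: "\<forall>\<^sub>F k in sequentially. j < n (diagseq k)" for j
    using filterlim_compose[OF n filterlim_subseq[OF subseq_diagseq]]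
    unfolding filterlim_at_top Suc_le_eq[symmetric] by blast
  have Ty: "T (y (Suc j)) = y j" for j
  proof -
    have "\<forall>\<^sub>F k in sequentially. T ((T ^^ (n (diagseq k) - Suc j)) (z (diagseq k)))
        = (T ^^ (n (diagseq k) - j)) (z (diagseq k))"
      using ev[of j]
    proof eventually_elim
      case (elim k)
      then have "n (diagseq k) - j = Suc (n (diagseq k) - Suc j)" by simp
      then show ?case by simp
    qed
    then have "(\<lambda>k. (T ^^ (n (diagseq k) - j)) (z (diagseq k))) \<longlonglongrightarrow> T (y (Suc j))"
      using T_tendsto[OF y[of "Suc j"]] by (rule Lim_transform_eventually[rotated])
    then show ?thesis using y LIMSEQ_unique by blast
  qed
  have yB: "y (Suc j) \<in> B R" for j
  proof (rule Lim_in_closed_set[OF B_closed _ _ y])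
    show "\<forall>\<^sub>F k in sequentially. (T ^^ (n (diagseq k) - Suc j)) (z (diagseq k)) \<in> B R"
      using ev[of j] by eventually_elim (simp add: z)
  qed simp
  define w where "w i = (if 0 \<le> i then (T ^^ nat i) (y 0) else y (nat (- i)))" for i
  have "w (i + 1) = T (w i)" for i
  proof (cases "0 \<le> i")
    case True
    then show ?thesis by (simp add: w_def nat_add_distrib)
  next
    case False
    then have "nat (- i) = Suc (nat (- (i + 1)))" by simp
    then show ?thesis using False Ty by (auto simp: w_def)
  qed
  moreover have "w i \<in> B R" if "i < 0" for i
    using that yB[of "nat (- i) - 1"] by (simp add: w_def)
  moreover have "w (- int j) = y j" for j by (cases j) (simp_all add: w_def nat_add_distrib)
  ultimately show ?thesis using that[OF subseq_diagseq, of w] y by simp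
qed

text \<open>The past is bounded by assumption, the future because \<open>w (- 1)\<close> is
  attracted. The index \<open>- 1\<close> is the last one at which a solution escaping from a fixed
  point is still known to be close to it, hence in \<open>G\<close>.\<close>

lemma orbitI:
  assumes w: "\<And>i. w (i + 1) = T (w i)" "\<And>i. i < 0 \<Longrightarrow> w i \<in> B R" and "w (- 1) \<in> G"
  shows "orbit w"
proof -
  obtain R' where R': "\<And>n. (T ^^ n) (w (-1)) \<in> B R'" using G_forward_bounded[OF assms(3)] by blast
  have it: "w (int n - 1) = (T ^^ n) (w (-1))" for n
  proof (induction n)
    case (Suc n)
    have "w (int (Suc n) - 1) = w ((int n - 1) + 1)" by simp
    then show ?case using Suc unfolding w(1) by simp
  qed simp
  have "w i \<in> B (max R R')" for i
  proof (cases "i < 0")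
    case True
    then show ?thesis using w(2) B_mono by (meson max.cobounded1 subsetD)
  next
    case False
    then have "w i \<in> B R'" using it[of "nat (i + 1)"] R' by simp
    then show ?thesis using B_mono by (meson max.cobounded2 subsetD)
  qed
  then show ?thesis using w by (auto simp: orbit_def)
qed

section \<open>Fixed points and connections between them\<close>

definition fixpts :: "'h set" where
  "fixpts = {p \<in> G. T p = p}"

lemma fixpts_S: "p \<in> fixpts \<Longrightarrow> p \<in> S"
proof -
  assume p: "p \<in> fixpts"
  then have "(T ^^ n) p = p" for n by (induction n) (auto simp: fixpts_def)
  then show "p \<in> S" using G_attr[of p] p by (simp add: fixpts_def)
qed

lemma fixpts_orbit: "p \<in> fixpts \<Longrightarrow> orbit (\<lambda>_. p)"
  by (simp add: orbit_const fixpts_def)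

lemma orbit_forward_limit:
  assumes w: "orbit w" and G: "w i \<in> G"
  obtains p where "p \<in> fixpts" "(\<lambda>n. \<phi> (w (int n))) \<longlonglongrightarrow> \<phi> p"
proof -
  obtain p r where p: "T p = p" "(\<lambda>n. \<phi> (w (1 * int n))) \<longlonglongrightarrow> \<phi> p" and r: "strict_mono r"
    and lim: "(\<lambda>n. w (1 * int (r n))) \<longlonglongrightarrow> p"
    using orbit_limit[OF w, of 1] by blast
  obtain N where N: "\<And>n. N \<le> n \<Longrightarrow> (T ^^ n) (w i) \<in> S"
    using G_attr[OF G] by (auto simp: eventually_sequentially)
  have "\<forall>\<^sub>F n in sequentially. w (int (r n)) \<in> S"
    using eventually_ge_at_top[of "nat (\<bar>i\<bar> + int N)"]
  proof eventually_elim
    case (elim n)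
    then have "nat (\<bar>i\<bar> + int N) \<le> r n" using seq_suble[OF r, of n] by linarith
    then have "i \<le> int (r n)" "N \<le> nat (int (r n) - i)" by linarith+
    then show ?case using orbit_iter'[OF w, of i "int (r n)"] N by simp
  qed
  then have "p \<in> S"
    using Lim_in_closed_set[OF S_closed _ _ lim] by simp
  then show ?thesis using that p S_G by (auto simp: fixpts_def)
qed

text \<open>The forward orbit of one attracted point, cut at later and later times, has a complete
  orbit among its limit points, and that orbit in turn has a fixed point as its forward
  limit.\<close>

lemma fixpts_nonempty: "fixpts \<noteq> {}"
proof -
  obtain u where "u \<in> G" using G_ne by blast
  then obtain N where N: "\<And>n. N \<le> n \<Longrightarrow> (T ^^ n) u \<in> S"
    using G_attr by (auto simp: eventually_sequentially)
  obtain R where R: "S \<subseteq> B R" using S_B by blast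
  define v where "v = (T ^^ N) u"
  have vS: "(T ^^ n) v \<in> S" for n
    using N[of "n + N"] by (simp add: v_def funpow_add)
  obtain r w where w: "\<And>i. w (i + 1) = T (w i)" "\<And>i. i < 0 \<Longrightarrow> w i \<in> B R"
    and lim: "\<And>j. (\<lambda>k. (T ^^ (r k - j)) v) \<longlonglongrightarrow> w (- int j)"
    by (rule backward_limit[of "\<lambda>k. k" "\<lambda>_. v" R]) (use vS R filterlim_ident in auto)
  have "w (- int 1) \<in> S"
    by (rule Lim_in_closed_set[OF S_closed _ _ lim]) (simp_all add: vS)
  then have G: "w (-1) \<in> G" using S_G by auto
  then show ?thesis
    using orbit_forward_limit[OF orbitI[OF w G] G] by blast
qed

text \<open>A fixed point is its own history of any length, so asymptotic compactness applies to
  every sequence of fixed points.\<close>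

lemma fixpts_compact: "compact fixpts"
  unfolding compact_eq_seq_compact_metric
proof (rule seq_compactI)
  fix f :: "nat \<Rightarrow> 'h" assume f: "\<forall>n. f n \<in> fixpts"
  obtain R where R: "S \<subseteq> B R" using S_B by blast
  have it: "(T ^^ n) (f k) = f k" for n k
    using f by (induction n) (auto simp: fixpts_def)
  have "\<exists>r l. strict_mono r \<and> (\<lambda>k. (T ^^ r k) (f (r k))) \<longlonglongrightarrow> l"
    by (rule T_compact[OF filterlim_ident, of _ R]) (use it f fixpts_S R in auto)
  then obtain r l where r: "strict_mono r" and lim: "(\<lambda>k. f (r k)) \<longlonglongrightarrow> l"
    by (auto simp: it)
  have "l \<in> S"
    by (rule Lim_in_closed_set[OF S_closed _ _ lim]) (use f fixpts_S in auto)
  moreover have "(\<lambda>k. f (r k)) \<longlonglongrightarrow> T l"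
    using T_tendsto[OF lim] f by (simp add: fixpts_def)
  then have "T l = l" using lim LIMSEQ_unique by blast
  ultimately show "\<exists>l\<in>fixpts. \<exists>r. strict_mono r \<and> (f \<circ> r) \<longlonglongrightarrow> l"
    using r lim S_G by (auto simp: fixpts_def o_def)
qed

text \<open>Only the \<open>\<phi>\<close>-values of the limits are recorded: they determine a fixed
  point in \<open>fixpts\<close>, and connections are compared through them. Constant orbits count
  as connections.\<close>

definition connection :: "(int \<Rightarrow> 'h) \<Rightarrow> 'h \<Rightarrow> 'h \<Rightarrow> bool" where
  "connection w a b \<longleftrightarrow> orbit w \<and> a \<in> fixpts \<and> b \<in> fixpts \<and>
     (\<lambda>n. \<phi> (w (- int n))) \<longlonglongrightarrow> \<phi> a \<and> (\<lambda>n. \<phi> (w (int n))) \<longlonglongrightarrow> \<phi> b"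

text \<open>Otherwise the two orbits would be ordered differently at a large negative and at a large
  positive time, which \<open>orbit_less\<close> forbids.\<close>

lemma connections_no_crossing:
  assumes "connection w a b" "connection z c d" and "\<phi> a < \<phi> c"
  shows "\<phi> b \<le> \<phi> d"
proof (rule ccontr)
  assume "\<not> \<phi> b \<le> \<phi> d"
  then have db: "\<phi> d < \<phi> b" by simp
  have w: "orbit w" "orbit z" using assms by (auto simp: connection_def)
  have "\<forall>\<^sub>F n in sequentially. \<phi> (w (- int n)) < \<phi> (z (- int n))"
    using eventually_less_of_limits[OF _ _ assms(3)] assms(1,2) 
    unfolding connection_def by blast
  then obtain n where "\<phi> (w (- int n)) < \<phi> (z (- int n))" by (auto simp: eventually_sequentially)
  moreover have "\<forall>\<^sub>F n in sequentially. \<phi> (z (int n)) < \<phi> (w (int n))"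
    using eventually_less_of_limits[OF _ _ db] assms(1,2)
    unfolding connection_def by blast
  then obtain m where "\<phi> (z (int m)) < \<phi> (w (int m))" by (auto simp: eventually_sequentially)
  ultimately show False
    using orbit_less[OF w, of "- int n" "int m"] by simp
qed

lemma connection_const: "x \<in> fixpts \<Longrightarrow> connection (\<lambda>_. x) x x"
  by (simp add: connection_def fixpts_orbit)

lemma fixpts_inj: "a \<in> fixpts \<Longrightarrow> b \<in> fixpts \<Longrightarrow> \<phi> a = \<phi> b \<Longrightarrow> a = b"
  using orbit_inj[OF fixpts_orbit fixpts_orbit] by blast

text \<open>
  The lowest fixed point above which no orbit connects upwards. A connection downwards from it
  would have to cross an upward connection starting below.
\<close>

lemma exists_terminal_fixpt:
  obtains p where "p \<in> fixpts" "\<And>w b. connection w p b \<Longrightarrow> b = p"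
proof -
  define X where "X = {x \<in> fixpts. \<forall>w a b. connection w a b \<longrightarrow> \<phi> a < \<phi> b \<longrightarrow> \<phi> a < \<phi> x}"
  have cont: "continuous_on A \<phi>" for A
    using \<phi>_lin linear_continuous_on by blast
  obtain m where m: "m \<in> fixpts" "\<And>x. x \<in> fixpts \<Longrightarrow> \<phi> x \<le> \<phi> m"
    using continuous_attains_sup[OF fixpts_compact fixpts_nonempty cont] by blast
  have "m \<in> X"
    unfolding X_def using m by (force simp: connection_def)
  have XF: "\<phi> ` X \<subseteq> \<phi> ` fixpts" by (auto simp: X_def)
  have cF: "compact (\<phi> ` fixpts)" by (rule compact_continuous_image[OF cont fixpts_compact])
  have bdd: "bdd_below (\<phi> ` X)"
    by (rule bdd_below_mono[OF bounded_imp_bdd_below[OF compact_imp_bounded[OF cF]] XF])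
  have "Inf (\<phi> ` X) \<in> closure (\<phi> ` X)"
    using \<open>m \<in> X\<close> bdd by (intro closure_contains_Inf) auto
  also have "\<dots> \<subseteq> \<phi> ` fixpts"
    using XF compact_imp_closed[OF cF] by (rule closure_minimal)
  finally obtain p where p: "p \<in> fixpts" "Inf (\<phi> ` X) = \<phi> p" by blast
  \<comment> \<open>The strict inequality in \<open>X\<close> is not inherited by an infimum for
    free. If an upward connection started at or above \<open>p\<close>, some \<open>x\<close> in
    \<open>X\<close> would lie strictly between its ends, and it would cross the constant orbit at
    \<open>x\<close>.\<close>
  have up: "\<phi> a < \<phi> p" if c: "connection w a b" "\<phi> a < \<phi> b" for w a b
  proof (rule ccontr)
    assume "\<not> \<phi> a < \<phi> p"
    then have "Inf (\<phi> ` X) < \<phi> b" using p c(2) by simp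
    then obtain x where x: "x \<in> X" "\<phi> x < \<phi> b"
      using cInf_lessD[of "\<phi> ` X" "\<phi> b"] \<open>m \<in> X\<close> by blast
    then have "\<phi> a < \<phi> x" using c by (auto simp: X_def)
    then show False
      using connections_no_crossing[OF c(1) connection_const] x by (force simp: X_def)
  qed
  have "b = p" if c: "connection w p b" for w b
  proof (rule ccontr)
    assume "b \<noteq> p"
    have b: "b \<in> fixpts" using c by (simp add: connection_def)
    with \<open>b \<noteq> p\<close> p have "\<phi> b \<noteq> \<phi> p" using fixpts_inj by blast
    moreover have "\<not> \<phi> p < \<phi> b" using up[OF c] by auto
    ultimately have bp: "\<phi> b < \<phi> p" by simp
    \<comment> \<open>Failing the condition of \<open>X\<close>, the point \<open>b\<close> has an
      upward connection starting at or above it. By \<open>up\<close> this starts below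
      \<open>p\<close>, so it cannot end above \<open>b\<close>.\<close>
    have "b \<notin> X"
      using cInf_lower[OF imageI bdd, of b] bp p by auto
    then obtain z y y' where z: "connection z y y'" "\<phi> y < \<phi> y'" "\<phi> b \<le> \<phi> y"
      using b by (auto simp: X_def not_less)
    have "\<phi> y < \<phi> p" by (rule up[OF z(1,2)])
    then have "\<phi> y' \<le> \<phi> b"
      by (rule connections_no_crossing[OF z(1) c])
    then show False using z by simp
  qed
  then show ?thesis using that p by blast
qed

text \<open>
  Comparing the escaping points with an arbitrary orbit above \<open>p\<close> shows that their limit lies
  below the forward limit of each such orbit, which leaves room for a fixed point only.
\<close>

lemma escape_limit:
  assumes p: "p \<in> fixpts" and terminal: "\<And>w b. connection w p b \<Longrightarrow> b = p"
    and w: "connection w a b" and above: "\<phi> p < \<phi> (w 0)"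
    and u: "u \<longlonglongrightarrow> p" and n: "filterlim n at_top sequentially"
    and lim: "(\<lambda>k. (T ^^ n k) (u k)) \<longlonglongrightarrow> w 0"
  shows "w (-1) = w 0 \<and> w 0 \<in> fixpts \<and> (\<forall>x\<in>fixpts. \<not> (\<phi> p < \<phi> x \<and> \<phi> x < \<phi> (w 0)))"
proof -
  have ow: "orbit w" and ab: "a \<in> fixpts" "b \<in> fixpts"
    and la: "(\<lambda>n. \<phi> (w (- int n))) \<longlonglongrightarrow> \<phi> a" and lb: "(\<lambda>n. \<phi> (w (int n))) \<longlonglongrightarrow> \<phi> b"
    using w by (auto simp: connection_def)
  \<comment> \<open>Since \<open>V (p - y 0)\<close> is strictly negative, \<open>u k\<close> is for
    large \<open>k\<close> comparable with \<open>y 0\<close> and below it. The order then persists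
    for all \<open>n k\<close> steps, however many.\<close>
  have compare: "\<phi> (w 0) \<le> L"
    if y: "orbit y" "\<phi> p < \<phi> (y 0)" "(\<lambda>n. \<phi> (y (int n))) \<longlonglongrightarrow> L" for y L
  proof -
    have "V (p - y 0) < 0"
      using orbit_cone_strict[OF fixpts_orbit[OF p] y(1), of 0] y(2) by simp
    moreover have "(\<lambda>k. V (u k - y 0)) \<longlonglongrightarrow> V (p - y 0)"
      by (intro V_tendsto tendsto_diff u tendsto_const)
    ultimately have "\<forall>\<^sub>F k in sequentially. V (u k - y 0) < 0"
      by (rule order_tendstoD(2)[rotated])
    moreover have "\<forall>\<^sub>F k in sequentially. \<phi> (u k) < \<phi> (y 0)"
      by (rule order_tendstoD(2)[OF \<phi>_cont[OF u] y(2)])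
    ultimately have "\<forall>\<^sub>F k in sequentially. \<phi> ((T ^^ n k) (u k)) \<le> \<phi> (y (int (n k)))"
    proof eventually_elim
      case (elim k)
      then show ?case
        using T_iter_mono[of "u k" "y 0" "n k"] orbit_iter[OF y(1), of 0 "n k"] by simp
    qed
    then show ?thesis
      by (rule tendsto_le[OF sequentially_bot filterlim_compose[OF y(3) n] \<phi>_cont[OF lim]])
  qed
  have "\<phi> p < \<phi> (w i)" for i
    using orbit_less[OF fixpts_orbit[OF p] ow, of 0] above by simp
  then have "\<phi> p \<le> \<phi> a"
    by (intro LIMSEQ_le_const[OF la]) (auto intro: less_imp_le)
  have wb: "\<phi> (w 0) \<le> \<phi> b" by (rule compare[OF ow above lb])
  \<comment> \<open>If \<open>w\<close> emanated from \<open>p\<close>, it would by terminality also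
    end there, below \<open>w 0\<close>.\<close>
  have "\<phi> p \<noteq> \<phi> a"
  proof
    assume "\<phi> p = \<phi> a"
    then have "connection w p b" using w p by (simp add: connection_def)
    then have "b = p" by (rule terminal)
    then show False using wb above by simp
  qed
  with \<open>\<phi> p \<le> \<phi> a\<close> have wa: "\<phi> (w 0) \<le> \<phi> a"
    using compare[OF fixpts_orbit[OF ab(1)], of "\<phi> a"] by simp
  \<comment> \<open>Now \<open>\<phi> (w 0)\<close> exceeds neither end value of the orbit, whereas
    on a strictly monotone orbit it exceeds one of them.\<close>
  have "\<not> \<phi> (w 0) < \<phi> (w 1)"
  proof
    assume up: "\<phi> (w 0) < \<phi> (w 1)"
    have "\<phi> a \<le> \<phi> (w (-1))"
    proof (rule LIMSEQ_le_const2[OF la], intro exI[of _ 1] allI impI)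
      fix m :: nat assume "1 \<le> m"
      then show "\<phi> (w (- int m)) \<le> \<phi> (w (- 1))"
        using orbit_up[OF ow up, of "- int m" "- 1"] by (cases "m = 1") auto
    qed
    then show False using orbit_up[OF ow up, of "-1" 0] wa by simp
  qed
  moreover have "\<not> \<phi> (w 1) < \<phi> (w 0)"
  proof
    assume dn: "\<phi> (w 1) < \<phi> (w 0)"
    have "\<phi> b \<le> \<phi> (w 1)"
    proof (rule LIMSEQ_le_const2[OF lb], intro exI[of _ 1] allI impI)
      fix m :: nat assume "1 \<le> m"
      then show "\<phi> (w (int m)) \<le> \<phi> (w 1)"
        using orbit_down[OF ow dn, of 1 "int m"] by (cases "m = 1") auto
    qed
    then show False using dn wb by simp
  qed
  ultimately have "\<phi> (w 0) = \<phi> (w 1)" by simp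
  then have "w 1 = w 0"
    using orbit_inj[OF ow orbit_shift[OF ow, of 1], of 0] by simp
  then have const: "w i = w 0" for i by (rule orbit_fixed[OF ow])
  have "(\<lambda>n. \<phi> (w (- int n))) = (\<lambda>_. \<phi> (w 0))"
    by (rule ext) (rule arg_cong[OF const])
  then have "\<phi> a = \<phi> (w 0)"
    using la by (simp add: LIMSEQ_const_iff)
  then have "w 0 = a"
    using orbit_inj[OF ow fixpts_orbit[OF ab(1)], of 0] by simp
  moreover have "\<not> (\<phi> p < \<phi> x \<and> \<phi> x < \<phi> (w 0))" if "x \<in> fixpts" for x
    using compare[OF fixpts_orbit[OF that] _ tendsto_const] by (meson not_less)
  ultimately show ?thesis using const[of "- 1"] ab(1) by simp
qed

text \<open>A successor of \<open>p\<close> in the \<open>\<phi>\<close>-order is unique, so its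
  distance to \<open>p\<close> serves as \<open>e\<close>; without a successor any \<open>e\<close>
  will do. This covers fixed points accumulating at \<open>p\<close> from above: none of them is a
  successor.\<close>

lemma successor_distance:
  "\<exists>e>0. \<forall>x\<in>fixpts. \<phi> p < \<phi> x \<longrightarrow> (\<forall>y\<in>fixpts. \<not> (\<phi> p < \<phi> y \<and> \<phi> y < \<phi> x)) \<longrightarrow> e \<le> dist x p"
proof (cases "\<exists>x\<in>fixpts. \<phi> p < \<phi> x \<and> (\<forall>y\<in>fixpts. \<not> (\<phi> p < \<phi> y \<and> \<phi> y < \<phi> x))")
  case True
  then obtain x where x: "x \<in> fixpts" "\<phi> p < \<phi> x" "\<forall>y\<in>fixpts. \<not> (\<phi> p < \<phi> y \<and> \<phi> y < \<phi> x)"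
    by blast
  then have "x' = x" if "x' \<in> fixpts" "\<phi> p < \<phi> x'" "\<forall>y\<in>fixpts. \<not> (\<phi> p < \<phi> y \<and> \<phi> y < \<phi> x')" for x'
    using that fixpts_inj by (metis linorder_neqE_linordered_idom)
  moreover have "0 < dist x p" using x by auto
  ultimately show ?thesis by (metis order_refl)
next
  case False
  then show ?thesis by (intro exI[of _ 1]) auto
qed

text \<open>\<open>V\<close> is even, so all axioms survive a reversal of the order, and what is
  proved above a fixed point also holds below it.\<close>

lemma cone_system_minus: "cone_system T V (\<lambda>x. - \<phi> x) \<kappa> C B G S"
proof (rule cone_system.intro)
  show "bounded_linear (\<lambda>x. - \<phi> x)" using \<phi>_lin by (rule bounded_linear_minus)
  show "- \<phi> (T u) < - \<phi> (T v)" if "V (u - v) \<le> 0" "- \<phi> u < - \<phi> v" for u v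
    using T_mono[of v u] that V_diff_commute[of u v] by simp
  show "x = 0" if "V x \<le> 0" "- \<phi> x = 0" for x using V_ker that by simp
  show "\<exists>r l. strict_mono r \<and> (\<lambda>k. (T ^^ n (r k)) (z (r k))) \<longlonglongrightarrow> l"
    if "filterlim n at_top sequentially" "\<And>k j. j < n k \<Longrightarrow> (T ^^ j) (z k) \<in> B R" for n z R
    using T_compact[OF that] .
qed (rule T_cont V_cont V_minus V_bound \<kappa>_gt1 B_closed B_local S_closed S_G S_B G_open G_ne
      | erule V_contract B_mono B_norm G_attr)+

theorem exists_stable_fixpt:
  obtains p where "p \<in> S" "T p = p"
    "\<And>\<epsilon>. 0 < \<epsilon> \<Longrightarrow> \<exists>\<eta>>0. \<forall>u. dist u p < \<eta> \<longrightarrow> (\<forall>n. dist ((T ^^ n) u) p < \<epsilon>)"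
proof -
  interpret neg: cone_system T V "\<lambda>x. - \<phi> x" \<kappa> C B G S by (rule cone_system_minus)
  have neg_connection: "neg.connection w a b \<longleftrightarrow> connection w a b" for w a b
    unfolding neg.connection_def connection_def by (simp add: tendsto_minus_cancel_left[symmetric])
  obtain p where p: "p \<in> fixpts" and terminal: "\<And>w b. connection w p b \<Longrightarrow> b = p"
    using exists_terminal_fixpt by blast
  have Tp: "T p = p" and pG: "p \<in> G" using p by (auto simp: fixpts_def)
  have Tnp: "(T ^^ n) p = p" for n by (induction n) (simp_all add: Tp)
  obtain e1 where e1: "0 < e1" "\<And>x. x \<in> fixpts \<Longrightarrow> \<phi> p < \<phi> x \<Longrightarrow>
      (\<forall>y\<in>fixpts. \<not> (\<phi> p < \<phi> y \<and> \<phi> y < \<phi> x)) \<Longrightarrow> e1 \<le> dist x p"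
    using successor_distance[of p] by blast
  obtain e2 where e2: "0 < e2" "\<And>x. x \<in> fixpts \<Longrightarrow> \<phi> x < \<phi> p \<Longrightarrow>
      (\<forall>y\<in>fixpts. \<not> (\<phi> y < \<phi> p \<and> \<phi> x < \<phi> y)) \<Longrightarrow> e2 \<le> dist x p"
    using neg.successor_distance[of p] unfolding neg_less_iff_less by blast
  obtain R e3 where e3: "0 < e3" "cball p e3 \<subseteq> B R" using B_local by blast
  obtain e4 where e4: "0 < e4" "cball p e4 \<subseteq> G" using G_open pG open_contains_cball by blast
  \<comment> \<open>Below \<open>e1\<close> and \<open>e2\<close> the ball contains no neighbour of
    \<open>p\<close> in the order; \<open>e3\<close> keeps the histories in one \<open>B R\<close>;
    \<open>e4\<close> places \<open>w (- 1)\<close> and the backward limit \<open>a\<close> in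
    \<open>G\<close>.\<close>
  have "\<exists>\<eta>>0. \<forall>u. dist u p < \<eta> \<longrightarrow> (\<forall>n. dist ((T ^^ n) u) p < \<epsilon>)"
    if \<epsilon>: "0 < \<epsilon>" "\<epsilon> < e1" "\<epsilon> < e2" "\<epsilon> \<le> e3" "\<epsilon> \<le> e4" for \<epsilon>
  proof (rule ccontr)
    assume "\<not> ?thesis"
    then have "\<exists>u. dist u p < inverse (real (Suc k)) \<and> (\<exists>n. \<epsilon> \<le> dist ((T ^^ n) u) p)" for k
      by (meson inverse_positive_iff_positive not_less of_nat_0_less_iff zero_less_Suc)
    then obtain u where u: "\<And>k. dist (u k) p < inverse (real (Suc k))"
      and ex: "\<And>k. \<exists>n. \<epsilon> \<le> dist ((T ^^ n) (u k)) p" by metis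
    \<comment> \<open>The first exit time: all earlier iterates stay in the ball, which is the
      history that compactness requires, while the exit point has distance at least
      \<open>\<epsilon>\<close>.\<close>
    define n where "n k = (LEAST n. \<epsilon> \<le> dist ((T ^^ n) (u k)) p)" for k
    have exit: "\<epsilon> \<le> dist ((T ^^ n k) (u k)) p" for k
      unfolding n_def by (rule LeastI_ex[OF ex])
    have before: "dist ((T ^^ j) (u k)) p < \<epsilon>" if "j < n k" for j k
      using not_less_Least that unfolding n_def by (metis not_less)
    have u_lim: "u \<longlonglongrightarrow> p"
      unfolding tendsto_dist_iff[of u]
      by (rule tendsto_sandwich[OF _ _ tendsto_const LIMSEQ_inverse_real_of_nat])
        (use u in \<open>auto intro!: always_eventually less_imp_le\<close>)
    \<comment> \<open>Each single iterate is continuous at \<open>p\<close>, so it cannot carry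
      \<open>u k\<close> out of the ball for large \<open>k\<close>.\<close>
    have n_lim: "filterlim n at_top sequentially"
      unfolding filterlim_at_top
    proof
      fix N
      have "\<forall>\<^sub>F k in sequentially. \<forall>j\<in>{..<N}. dist ((T ^^ j) (u k)) p < \<epsilon>"
        using T_iter_tendsto[OF u_lim] \<epsilon>(1) by (intro eventually_ball_finite) (auto simp: Tnp tendsto_iff)
      then show "\<forall>\<^sub>F k in sequentially. N \<le> n k"
      proof eventually_elim
        case (elim k)
        then show ?case using exit[of k] by (metis lessThan_iff not_less)
      qed
    qed
    have hist: "(T ^^ j) (u k) \<in> B R" if "j < n k" for j k
      using before[OF that] e3(2) \<epsilon>(4) by (auto simp: subset_iff dist_commute)
    obtain r w where r: "strict_mono r" and w: "\<And>i. w (i + 1) = T (w i)" "\<And>i. i < 0 \<Longrightarrow> w i \<in> B R"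
      and lim: "\<And>j. (\<lambda>k. (T ^^ (n (r k) - j)) (u (r k))) \<longlonglongrightarrow> w (- int j)"
      using backward_limit[where n = n and z = u and R = R, OF n_lim hist] by blast
    have nr: "filterlim (\<lambda>k. n (r k)) at_top sequentially"
      by (rule filterlim_compose[OF n_lim filterlim_subseq[OF r]])
    have near: "dist (w (- int j)) p \<le> \<epsilon>" if "0 < j" for j
    proof (rule tendsto_upperbound[OF tendsto_dist[OF lim tendsto_const]])
      have "\<forall>\<^sub>F k in sequentially. Suc 0 \<le> n (r k)"
        using nr by (simp add: filterlim_at_top)
      then show "\<forall>\<^sub>F k in sequentially. dist ((T ^^ (n (r k) - j)) (u (r k))) p \<le> \<epsilon>"
        by eventually_elim (use that before in \<open>simp add: less_imp_le\<close>)
    qed simp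
    have lim0: "(\<lambda>k. (T ^^ n (r k)) (u (r k))) \<longlonglongrightarrow> w 0" using lim[of 0] by simp
    have far: "\<epsilon> \<le> dist (w 0) p"
      by (rule tendsto_lowerbound[OF tendsto_dist[OF lim0 tendsto_const]]) (simp_all add: exit)
    have near1: "dist (w (- 1)) p \<le> \<epsilon>" using near[of 1] by simp
    then have G: "w (- 1) \<in> G" using \<epsilon>(5) e4(2) by (auto simp: subset_iff dist_commute)
    have ow: "orbit w" by (rule orbitI[OF w G])
    obtain b where b: "b \<in> fixpts" "(\<lambda>n. \<phi> (w (int n))) \<longlonglongrightarrow> \<phi> b"
      using orbit_forward_limit[OF ow G] by blast
    obtain a s where a: "T a = a" "(\<lambda>n. \<phi> (w (- 1 * int n))) \<longlonglongrightarrow> \<phi> a"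
      and s: "strict_mono s" "(\<lambda>n. w (- 1 * int (s n))) \<longlonglongrightarrow> a"
      using orbit_limit[OF ow, of "- 1"] by blast
    have "dist a p \<le> \<epsilon>"
    proof (rule tendsto_upperbound[OF tendsto_dist[OF s(2) tendsto_const]])
      show "\<forall>\<^sub>F n in sequentially. dist (w (- 1 * int (s n))) p \<le> \<epsilon>"
        using eventually_gt_at_top[of 0]
      proof eventually_elim
        case (elim n)
        then show ?case using near[of "s n"] seq_suble[OF s(1), of n] by simp
      qed
    qed simp
    then have "a \<in> fixpts" using a \<epsilon>(5) e4(2) by (auto simp: fixpts_def subset_iff dist_commute)
    then have conn: "connection w a b" using a b ow by (simp add: connection_def)
    have u_r: "(\<lambda>k. u (r k)) \<longlonglongrightarrow> p" using LIMSEQ_subseq_LIMSEQ[OF u_lim r] by (simp add: o_def)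
    \<comment> \<open>Unless \<open>w 0 = p\<close>, which the exit distance excludes,
      \<open>w 0 = w (- 1)\<close> is an immediate neighbour of \<open>p\<close> in the order, yet
      within \<open>\<epsilon>\<close> of it.\<close>
    show False
    proof (rule linorder_cases[of "\<phi> p" "\<phi> (w 0)"])
      assume "\<phi> p < \<phi> (w 0)"
      from escape_limit[OF p terminal conn this u_r nr lim0]
      show False using e1(2)[of "w 0"] near1 \<epsilon>(2) \<open>\<phi> p < \<phi> (w 0)\<close> by auto
    next
      assume less: "\<phi> (w 0) < \<phi> p"
      then have "- \<phi> p < - \<phi> (w 0)" by simp
      from neg.escape_limit[where p = p and w = w, unfolded neg_connection, OF p terminal conn this u_r nr lim0]
      show False using e2(2)[of "w 0"] near1 \<epsilon>(3) less by auto
    next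
      assume "\<phi> p = \<phi> (w 0)"
      then have "w 0 = p" using orbit_inj[OF ow fixpts_orbit[OF p], of 0] by simp
      then show False using far \<epsilon>(1) by simp
    qed
  qed note small = this
  have "\<exists>\<eta>>0. \<forall>u. dist u p < \<eta> \<longrightarrow> (\<forall>n. dist ((T ^^ n) u) p < \<epsilon>)" if "0 < \<epsilon>" for \<epsilon>
  proof -
    define \<epsilon>' where "\<epsilon>' = Min {\<epsilon>, e1 / 2, e2 / 2, e3, e4}"
    have "0 < \<epsilon>'" "\<epsilon>' \<le> e1 / 2" "\<epsilon>' \<le> e2 / 2" "\<epsilon>' \<le> e3" "\<epsilon>' \<le> e4" "\<epsilon>' \<le> \<epsilon>"
      unfolding \<epsilon>'_def using that e1(1) e2(1) e3(1) e4(1) by simp_all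
    then obtain \<eta> where "0 < \<eta>" "\<forall>u. dist u p < \<eta> \<longrightarrow> (\<forall>n. dist ((T ^^ n) u) p < \<epsilon>')"
      using small[of \<epsilon>'] e1(1) e2(1) by auto
    then show ?thesis using \<open>\<epsilon>' \<le> \<epsilon>\<close> by (meson less_le_trans)
  qed
  then show ?thesis using that fixpts_S[OF p] Tp by blast
qed

end

section \<open>Asymptotic compactness and the period map of a squeezing cocycle\<close>

text \<open>A Riesz--Fischer argument: the weighted sums of squares stay bounded on nested compact sets.\<close>

lemma L2_Cauchy_imp_pointwise_convergent:
  fixes g :: "nat \<Rightarrow> real \<Rightarrow> 'a::{real_normed_vector, complete_space}"
  assumes ab: "a < b" and cont: "\<And>k. continuous_on {a..b} (g k)"
    and Cauchy: "\<And>\<epsilon>. 0 < \<epsilon> \<Longrightarrow>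
      \<exists>N. \<forall>k\<ge>N. \<forall>j\<ge>N. integral {a..b} (\<lambda>s. (norm (g k s - g j s))\<^sup>2) < \<epsilon>"
  obtains s r where "s \<in> {a..b}" "strict_mono (r :: nat \<Rightarrow> nat)" "convergent (\<lambda>i. g (r i) s)"
proof -
  \<comment> \<open>With the weights \<open>2 ^ i\<close> of \<open>f\<close> these bounds become
    \<open>(b - a) / 2 ^ (i + 1)\<close>. Their partial sums stay below the length of the interval,
    so no \<open>f n\<close> exceeds 1 everywhere.\<close>
  define Q where "Q i N \<longleftrightarrow>
    (\<forall>k\<ge>N. \<forall>j\<ge>N. integral {a..b} (\<lambda>s. (norm (g k s - g j s))\<^sup>2) < (b - a) * (1 / 4) ^ i / 2)" for i N
  have "\<exists>N. Q i N" for i unfolding Q_def using ab by (intro Cauchy) simp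
  then obtain N where N: "\<And>i. Q i (N i)" by metis
  define r where "r i = i + (\<Sum>j\<le>i. N j)" for i
  have r: "strict_mono r" by (auto simp: r_def strict_mono_Suc_iff)
  have "Q i (r i)" for i
  proof -
    have "N i \<le> r i" unfolding r_def by (simp add: sum.atMost_Suc trans_le_add2 member_le_sum)
    then show ?thesis using N[of i] unfolding Q_def by (meson order_trans)
  qed
  moreover have "r i \<le> r (Suc i)" for i using r by (simp add: strict_mono_Suc_iff less_imp_le)
  ultimately have Qr: "integral {a..b} (\<lambda>s. (norm (g (r (Suc i)) s - g (r i) s))\<^sup>2) < (b - a) * (1 / 4) ^ i / 2" for i
    unfolding Q_def by blast
  define f where "f n s = (\<Sum>i<n. 2 ^ i * (norm (g (r (Suc i)) s - g (r i) s))\<^sup>2)" for n s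
  have sq_cont: "continuous_on {a..b} (\<lambda>s. (norm (g (r (Suc i)) s - g (r i) s))\<^sup>2)" for i
    by (intro continuous_intros cont)
  have f_cont: "continuous_on {a..b} (f n)" for n
    unfolding f_def by (intro continuous_intros cont)
  have int_f: "integral {a..b} (f n) \<le> (b - a) * (1 - (1 / 2) ^ n)" for n
  proof (induction n)
    case (Suc n)
    have "integral {a..b} (f (Suc n)) = integral {a..b} (\<lambda>s. f n s + 2 ^ n * (norm (g (r (Suc n)) s - g (r n) s))\<^sup>2)"
      by (rule arg_cong[of _ _ "integral {a..b}"]) (simp add: f_def fun_eq_iff)
    also have "\<dots> = integral {a..b} (f n) + 2 ^ n * integral {a..b} (\<lambda>s. (norm (g (r (Suc n)) s - g (r n) s))\<^sup>2)"
      by (subst Henstock_Kurzweil_Integration.integral_add)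
        (auto intro!: integrable_continuous_real f_cont sq_cont continuous_on_mult continuous_on_const)
    also have "\<dots> \<le> (b - a) * (1 - (1 / 2) ^ n) + 2 ^ n * ((b - a) * (1 / 4) ^ n / 2)"
      using Suc Qr[of n] by (intro add_mono mult_left_mono) auto
    also have "\<dots> = (b - a) * (1 - (1 / 2) ^ Suc n)"
    proof -
      have "(2::real) ^ n * (1 / 4) ^ n = (1 / 2) ^ n"
        by (simp flip: power_mult_distrib)
      then have "2 ^ n * ((b - a) * (1 / 4) ^ n / 2) = (b - a) * ((1 / 2) ^ n / 2)"
        by (metis (no_types, lifting) mult.left_commute times_divide_eq_right)
      then show ?thesis by (simp only:) (simp add: field_simps)
    qed
    finally show ?case .
  qed (simp add: f_def)
  define K where "K n = {s \<in> {a..b}. f n s \<le> 1}" for n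
  have "compact (K n)" for n
  proof -
    have "closed (K n)"
      unfolding K_def by (intro continuous_on_closed_Collect_le f_cont continuous_on_const) simp
    moreover have "{a..b} \<inter> K n = K n" by (auto simp: K_def)
    ultimately show ?thesis using compact_Int_closed[of "{a..b}" "K n"] by simp
  qed
  moreover have "K n \<noteq> {}" for n
  proof
    assume "K n = {}"
    then have "1 \<le> f n s" if "s \<in> {a..b}" for s using that by (force simp: K_def)
    then have "integral {a..b} (\<lambda>_. 1::real) \<le> integral {a..b} (f n)"
      by (intro integral_le integrable_continuous_real f_cont continuous_on_const) auto
    also have "\<dots> \<le> (b - a) * (1 - (1 / 2) ^ n)" by (rule int_f)
    also have "\<dots> < b - a" using ab by (simp add: algebra_simps)
    finally show False using ab by simp
  qed
  moreover have "K n \<subseteq> K m" if "m \<le> n" for m n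
  proof -
    have "f m s \<le> f n s" for s
      unfolding f_def using that by (intro sum_mono2) auto
    then show ?thesis unfolding K_def by (auto intro: order_trans)
  qed
  ultimately have "\<Inter> (range K) \<noteq> {}" by (rule compact_nest)
  then obtain s where s: "\<And>n. s \<in> K n" by blast
  \<comment> \<open>At the common point \<open>s\<close> every weighted square is at most 1, so the
    increments decay geometrically with ratio \<open>1 / sqrt 2\<close>.\<close>
  have small: "norm (g (r (Suc i)) s - g (r i) s) \<le> (1 / sqrt 2) ^ i" for i
  proof -
    have "2 ^ i * (norm (g (r (Suc i)) s - g (r i) s))\<^sup>2 \<le> f (Suc i) s"
      unfolding f_def by (rule member_le_sum) auto
    also have "\<dots> \<le> 1" using s[of "Suc i"] by (simp add: K_def)
    finally have "(norm (g (r (Suc i)) s - g (r i) s))\<^sup>2 \<le> 1 / 2 ^ i"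
      by (simp add: field_simps)
    also have "\<dots> = ((1 / sqrt 2)\<^sup>2) ^ i"
      by (simp add: power_divide)
    also have "\<dots> = ((1 / sqrt 2) ^ i)\<^sup>2"
      by (simp only: power_mult[symmetric] mult.commute)
    finally show ?thesis by (rule power2_le_imp_le) simp
  qed
  define A where "A n = (\<Sum>i<n. (1 / sqrt 2) ^ i)" for n
  have "summable (\<lambda>i. (1 / sqrt 2) ^ i)" by (rule summable_geometric) simp
  then have A: "Cauchy A"
    unfolding A_def summable_iff_convergent Cauchy_convergent_iff .
  have diff: "norm (g (r m) s - g (r n) s) \<le> norm (A m - A n)" if "m \<le> n" for m n
  proof -
    have "norm (g (r m) s - g (r n) s) \<le> A n - A m"
      using that
    proof (induction rule: dec_induct)
      case (step n)
      have "norm (g (r m) s - g (r (Suc n)) s) \<le> norm (g (r m) s - g (r n) s) + norm (g (r (Suc n)) s - g (r n) s)"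
        using norm_triangle_ineq4[of "g (r m) s - g (r n) s" "g (r (Suc n)) s - g (r n) s"] by simp
      then show ?case using step small[of n] by (simp add: A_def)
    qed simp
    then show ?thesis by (simp add: norm_minus_commute[of "A m"])
  qed
  have "Cauchy (\<lambda>n. g (r n) s)"
  proof (rule CauchyI')
    fix \<epsilon> :: real assume "0 < \<epsilon>"
    then obtain M where "\<forall>m\<ge>M. \<forall>n\<ge>M. norm (A m - A n) < \<epsilon>" using CauchyD[OF A] by blast
    then show "\<exists>M. \<forall>m\<ge>M. \<forall>n>m. dist (g (r m) s) (g (r n) s) < \<epsilon>"
      using diff unfolding dist_norm by (meson le_less_trans less_imp_le order_trans)
  qed
  then have "convergent (\<lambda>n. g (r n) s)" by (rule Cauchy_convergent)
  then show ?thesis using that s[of 0] r by (auto simp: K_def)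
qed

lemma circle_point_period: "circle_point \<sigma> (s + real n * \<sigma>) = circle_point \<sigma> s"
proof (rule circle_point_eqI)
  have "s + real n * \<sigma> = s + of_int (int n) * \<sigma>" by simp
  then show "s + real n * \<sigma> \<in> circle_point \<sigma> s" unfolding circle_point_def by blast
qed

lemma compact_map_subseq:
  assumes "compact_map f" and "\<And>k. norm (x k) \<le> R"
  obtains r l where "strict_mono (r :: nat \<Rightarrow> nat)" "(\<lambda>k. f (x (r k))) \<longlonglongrightarrow> l"
proof -
  have "compact (closure (f ` cball 0 R))"
    using assms(1) bounded_cball unfolding compact_map_def by blast
  then have "seq_compact (closure (f ` cball 0 R))"
    by (simp add: compact_eq_seq_compact_metric)
  moreover have "\<forall>k. f (x k) \<in> closure (f ` cball 0 R)"
    using assms(2) by (intro allI subsetD[OF closure_subset] imageI) simp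
  ultimately obtain l r where "strict_mono r" "((\<lambda>k. f (x k)) \<circ> r) \<longlonglongrightarrow> l"
    by (rule seq_compactE)
  then show ?thesis using that by (simp add: o_def)
qed

text \<open>Here \<open>e\<close> stands for a vector spanning the negative subspace. The splitting
  enters through \<open>P_ker\<close>: the form is positive on non-zero vectors orthogonal to
  \<open>e\<close>.\<close>

locale squeezing_cocycle =
  fixes \<sigma> :: real
    and \<psi> :: "real \<Rightarrow> real set \<Rightarrow> 'h \<Rightarrow> 'h::{real_inner, complete_space}"
    and P :: "'h \<Rightarrow> 'h" and e :: 'h and \<delta> \<nu> :: real and G S\<^sub>0 :: "'h set"
  assumes \<sigma>_pos: "0 < \<sigma>" and periodic: "periodic_cocycle \<sigma> \<psi>"
    and P_lin: "bounded_linear P"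
    and P_ker: "quadratic_form P x \<le> 0 \<Longrightarrow> x \<bullet> e = 0 \<Longrightarrow> x = 0"
    and \<delta>_pos: "0 < \<delta>" and \<nu>_pos: "0 < \<nu>"
    and squeeze: "q \<in> circle \<sigma> \<Longrightarrow> 0 \<le> l \<Longrightarrow> l \<le> r \<Longrightarrow>
      exp (2 * \<nu> * r) * quadratic_form P (\<psi> r q u - \<psi> r q v)
        - exp (2 * \<nu> * l) * quadratic_form P (\<psi> l q u - \<psi> l q v)
      \<le> - \<delta> * integral {l..r} (\<lambda>s. exp (2 * \<nu> * s) * (norm (\<psi> s q u - \<psi> s q v))\<^sup>2)"
    and compactness: "compact_map P \<or> (\<exists>t\<^sub>c>0. \<forall>q\<in>circle \<sigma>. compact_map (\<psi> t\<^sub>c q))"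
    and S0_ne: "S\<^sub>0 \<noteq> {}" and S0_bounded: "bounded S\<^sub>0" and S0_closed: "closed S\<^sub>0"
    and G_open: "open G" and S0_G: "S\<^sub>0 \<subseteq> G"
    and G_attracted: "u \<in> G \<Longrightarrow> q \<in> circle \<sigma> \<Longrightarrow> \<exists>T\<ge>0. \<forall>t\<ge>T. \<psi> t q u \<in> S\<^sub>0"
begin

section \<open>Trajectories over the base point and the period map\<close>

definition base :: "real set" where "base = circle_point \<sigma> 0"

lemma base_circle: "base \<in> circle \<sigma>"
  by (simp add: base_def circle_def)

lemma rotation_in_circle: "p \<in> circle \<sigma> \<Longrightarrow> rotation t p \<in> circle \<sigma>"
  by (auto simp: circle_def rotation_circle_point)

lemma rotation_period: "rotation (s + real n * \<sigma>) base = rotation s base"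
  unfolding base_def rotation_circle_point using circle_point_period[of \<sigma> s n] by simp

lemma rotation_base_0: "rotation 0 base = base"
  by (simp add: base_def rotation_circle_point)

lemma \<psi>_0: "p \<in> circle \<sigma> \<Longrightarrow> \<psi> 0 p u = u"
  and \<psi>_add: "p \<in> circle \<sigma> \<Longrightarrow> 0 \<le> t \<Longrightarrow> 0 \<le> s \<Longrightarrow> \<psi> (t + s) p u = \<psi> t (rotation s p) (\<psi> s p u)"
  using periodic unfolding periodic_cocycle_def cocycle_def by blast+

lemma \<psi>_cont:
  assumes p: "p \<in> circle \<sigma>"
  shows "continuous_on ({0..} \<times> UNIV) (\<lambda>z. \<psi> (fst z) p (snd z))"
proof -
  interpret Metric_space "circle \<sigma>" setdist by (rule Metric_space_circle)
  have "continuous_map (prod_topology (top_of_set {0..}) (prod_topology mtopology euclidean))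
      euclidean (\<lambda>(t, q, u). \<psi> t q u)"
    using periodic unfolding periodic_cocycle_def cocycle_def by blast
  moreover have "continuous_map (top_of_set ({0..} \<times> UNIV))
      (prod_topology (top_of_set {0..}) (prod_topology mtopology euclidean))
      (\<lambda>z::real \<times> 'h. (fst z, p, snd z))"
    unfolding continuous_map_paired continuous_map_in_subtopology
    using p by (auto simp: continuous_on_fst continuous_on_snd continuous_on_id)
  ultimately have "continuous_map (top_of_set ({0..} \<times> UNIV)) euclidean
      ((\<lambda>(t, q, u). \<psi> t q u) \<circ> (\<lambda>z. (fst z, p, snd z)))"
    by (rule continuous_map_compose[rotated])
  then show ?thesis by (simp add: o_def)
qed

lemma \<psi>_cont_t: "p \<in> circle \<sigma> \<Longrightarrow> continuous_on {0..} (\<lambda>t. \<psi> t p u)"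
  by (rule continuous_on_compose2[OF \<psi>_cont, of p "{0..}" "\<lambda>t. (t, u)", unfolded fst_conv snd_conv])
    (auto intro!: continuous_intros)

lemma \<psi>_cont_u: "p \<in> circle \<sigma> \<Longrightarrow> 0 \<le> t \<Longrightarrow> continuous_on UNIV (\<psi> t p)"
  by (rule continuous_on_compose2[OF \<psi>_cont, of p UNIV "\<lambda>u. (t, u)", unfolded fst_conv snd_conv])
    (auto intro!: continuous_intros)

lemma \<psi>_tendsto: "p \<in> circle \<sigma> \<Longrightarrow> 0 \<le> t \<Longrightarrow> (f \<longlongrightarrow> l) F \<Longrightarrow> ((\<lambda>x. \<psi> t p (f x)) \<longlongrightarrow> \<psi> t p l) F"
  by (rule continuous_on_tendsto_compose[OF \<psi>_cont_u]) auto

text \<open>Compactness of one period makes the continuity at \<open>x0\<close> uniform in time.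
  This is what carries statements about iterates over to all times.\<close>

lemma period_tube:
  assumes "0 < \<epsilon>"
  obtains \<eta> where "0 < \<eta>" "\<And>x s. dist x x0 < \<eta> \<Longrightarrow> s \<in> {0..\<sigma>} \<Longrightarrow> dist (\<psi> s base x) (\<psi> s base x0) < \<epsilon>"
proof -
  have cont: "continuous_on (UNIV \<times> {0..\<sigma>}) (\<lambda>z. \<psi> (snd z) base (fst z))"
    by (rule continuous_on_compose2[OF \<psi>_cont[OF base_circle], of "UNIV \<times> {0..\<sigma>}" "\<lambda>z. (snd z, fst z)",
          unfolded fst_conv snd_conv]) (auto intro!: continuous_intros)
  obtain X where X: "x0 \<in> X" "open X"
    "\<forall>x\<in>X \<inter> UNIV. \<forall>t\<in>{0..\<sigma>}. dist (\<psi> (snd (x, t)) base (fst (x, t))) (\<psi> (snd (x0, t)) base (fst (x0, t))) \<le> \<epsilon> / 2"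
    by (rule continuous_on_prod_compactE[OF cont compact_Icc, of x0 "\<epsilon> / 2"]) (use assms in auto)
  obtain \<eta> where "0 < \<eta>" "ball x0 \<eta> \<subseteq> X" using X openE by metis
  moreover have "dist (\<psi> s base x) (\<psi> s base x0) < \<epsilon>" if "dist x x0 < \<eta>" "s \<in> {0..\<sigma>}" for x s
  proof -
    have "x \<in> X" using that(1) \<open>ball x0 \<eta> \<subseteq> X\<close> by (auto simp: subset_iff dist_commute)
    then have "dist (\<psi> s base x) (\<psi> s base x0) \<le> \<epsilon> / 2" using X(3) that(2) by simp
    then show ?thesis using assms by simp
  qed
  ultimately show ?thesis using that by blast
qed

definition monodromy :: "'h \<Rightarrow> 'h" where "monodromy = \<psi> \<sigma> base"

lemma \<psi>_add_period:
  assumes "0 \<le> t"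
  shows "\<psi> (t + real n * \<sigma>) base u = \<psi> t base (\<psi> (real n * \<sigma>) base u)"
  using \<psi>_add[OF base_circle assms, of "real n * \<sigma>" u] rotation_period[of 0 n] \<sigma>_pos rotation_base_0 by simp

lemma monodromy_iter: "(monodromy ^^ n) u = \<psi> (real n * \<sigma>) base u"
proof (induction n)
  case (Suc n)
  then show ?case
    using \<psi>_add_period[of \<sigma> n u] \<sigma>_pos by (simp add: monodromy_def algebra_simps)
qed (simp add: \<psi>_0 base_circle)

lemma \<psi>_iter: "0 \<le> t \<Longrightarrow> \<psi> (t + real n * \<sigma>) base u = \<psi> t base ((monodromy ^^ n) u)"
  by (simp add: \<psi>_add_period monodromy_iter)

lemma period_decompose:
  assumes "0 \<le> t"
  obtains n s where "t = s + real n * \<sigma>" "s \<in> {0..\<sigma>}"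
proof
  define n where "n = nat \<lfloor>t / \<sigma>\<rfloor>"
  have "0 \<le> t / \<sigma>" using assms \<sigma>_pos by simp
  then have n: "real n \<le> t / \<sigma>" "t / \<sigma> \<le> real n + 1"
    unfolding n_def by linarith+
  show "t = (t - real n * \<sigma>) + real n * \<sigma>" by simp
  show "t - real n * \<sigma> \<in> {0..\<sigma>}"
    using n \<sigma>_pos by (simp add: field_simps)
qed

section \<open>The quadratic form along differences of trajectories\<close>

definition V :: "'h \<Rightarrow> real" where "V = quadratic_form P"

lemma V_cont: "continuous_on UNIV V"
  unfolding V_def quadratic_form_def
  by (intro continuous_intros linear_continuous_on P_lin)

lemma V_minus: "V (- x) = V x"
  using bounded_linear.linear[OF P_lin] by (simp add: V_def quadratic_form_def linear_neg)

lemma V_bound: "\<bar>V x\<bar> \<le> onorm P * (norm x)\<^sup>2"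
proof -
  have "\<bar>V x\<bar> \<le> norm (P x) * norm x"
    unfolding V_def quadratic_form_def by (rule Cauchy_Schwarz_ineq2)
  also have "\<dots> \<le> (onorm P * norm x) * norm x"
    by (intro mult_right_mono onorm P_lin) simp
  finally show ?thesis by (simp add: power2_eq_square)
qed

abbreviation sq_dist :: "'h \<Rightarrow> 'h \<Rightarrow> real \<Rightarrow> real" where
  "sq_dist u v s \<equiv> exp (2 * \<nu> * s) * (norm (\<psi> s base u - \<psi> s base v))\<^sup>2"

lemma sq_dist_cont: "continuous_on {0..t} (sq_dist u v)"
  by (intro continuous_intros continuous_on_subset[OF \<psi>_cont_t[OF base_circle]]) auto

lemma V_decrease:
  "0 \<le> t \<Longrightarrow> exp (2 * \<nu> * t) * V (\<psi> t base u - \<psi> t base v) + \<delta> * integral {0..t} (sq_dist u v) \<le> V (u - v)"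
  using squeeze[OF base_circle, of 0 t u v] by (simp add: V_def \<psi>_0 base_circle)

text \<open>The integrand is continuous and nonnegative, and at \<open>s = 0\<close> it is the
  squared distance of \<open>u\<close> and \<open>v\<close>; it may vanish later if the trajectories
  merge.\<close>

lemma integral_sq_dist_pos:
  assumes "0 < t" "u \<noteq> v"
  shows "0 < integral {0..t} (sq_dist u v)"
proof -
  have "integral {0..t} (sq_dist u v) \<noteq> 0"
  proof
    assume "integral {0..t} (sq_dist u v) = 0"
    then have "sq_dist u v 0 = 0"
      using integral_eq_0_iff[OF sq_dist_cont, of t u v] assms by auto
    then show False using assms by (simp add: \<psi>_0 base_circle)
  qed
  moreover have "0 \<le> integral {0..t} (sq_dist u v)"
    by (rule Henstock_Kurzweil_Integration.integral_nonneg)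
      (auto intro: integrable_continuous_real sq_dist_cont)
  ultimately show ?thesis by simp
qed

lemma V_decrease_strict:
  "0 < t \<Longrightarrow> u \<noteq> v \<Longrightarrow> exp (2 * \<nu> * t) * V (\<psi> t base u - \<psi> t base v) < V (u - v)"
  using V_decrease[of t u v] mult_pos_pos[OF \<delta>_pos integral_sq_dist_pos[of t u v]] by linarith

lemma V_decrease_weak:
  "0 \<le> t \<Longrightarrow> exp (2 * \<nu> * t) * V (\<psi> t base u - \<psi> t base v) \<le> V (u - v)"
  using V_decrease_strict[of t u v] \<psi>_0[OF base_circle]
  by (cases "t = 0 \<or> u = v") (auto simp: V_def quadratic_form_def)

text \<open>
  Inside the cone the projection to \<open>e\<close> of the difference of two trajectories cannot vanish,
  so by continuity in time it keeps its sign.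
\<close>

lemma monodromy_mono:
  assumes V: "V (u - v) \<le> 0" and less: "u \<bullet> e < v \<bullet> e"
  shows "monodromy u \<bullet> e < monodromy v \<bullet> e"
proof (rule ccontr)
  define f where "f t = (\<psi> t base v - \<psi> t base u) \<bullet> e" for t
  assume "\<not> ?thesis"
  then have "f \<sigma> \<le> 0" by (simp add: f_def monodromy_def inner_diff_left)
  moreover have f0: "0 < f 0" using less by (simp add: f_def \<psi>_0 base_circle inner_diff_left)
  moreover have "continuous_on {0..\<sigma>} f"
    unfolding f_def by (intro continuous_intros continuous_on_subset[OF \<psi>_cont_t[OF base_circle]]) auto
  ultimately obtain t where t: "0 \<le> t" "t \<le> \<sigma>" "f t = 0"
    using IVT2'[of f \<sigma> 0 0] \<sigma>_pos by auto
  then have "0 < t" using f0 by (cases "t = 0") auto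
  moreover have "u \<noteq> v" using less by auto
  ultimately have "exp (2 * \<nu> * t) * V (\<psi> t base u - \<psi> t base v) < 0"
    using less_le_trans[OF V_decrease_strict V] by blast
  then have neg: "V (\<psi> t base u - \<psi> t base v) < 0" by (simp add: mult_less_0_iff)
  moreover have "(\<psi> t base u - \<psi> t base v) \<bullet> e = 0" using t(3) by (simp add: f_def inner_diff_left)
  ultimately have "\<psi> t base u - \<psi> t base v = 0" by (intro P_ker) (simp_all add: V_def)
  then show False using neg by (simp add: V_def quadratic_form_def)
qed

text \<open>A norm bound at one time does not bound the trajectory during the following period, so
  it is imposed on the whole period. The same device in \<open>period_sink\<close> keeps the
  periodic trajectory in \<open>S\<^sub>0\<close> between the iterates.\<close>

definition period_ball :: "real \<Rightarrow> 'h set" where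
  "period_ball R = {x. \<forall>s\<in>{0..\<sigma>}. norm (\<psi> s base x) \<le> R}"

definition period_sink :: "'h set" where
  "period_sink = {x. \<forall>s\<in>{0..\<sigma>}. \<psi> s base x \<in> S\<^sub>0}"

lemma closed_period_set:
  assumes "closed A"
  shows "closed {x. \<forall>s\<in>{0..\<sigma>}. \<psi> s base x \<in> A}"
proof -
  have "closed (\<psi> s base -` A)" if "s \<in> {0..\<sigma>}" for s
    by (rule continuous_closed_vimage[OF assms])
      (use that \<psi>_cont_u[OF base_circle, of s] in \<open>simp add: continuous_on_eq_continuous_at\<close>)
  then have "closed (\<Inter>s\<in>{0..\<sigma>}. \<psi> s base -` A)" by (intro closed_INT) auto
  moreover have "{x. \<forall>s\<in>{0..\<sigma>}. \<psi> s base x \<in> A} = (\<Inter>s\<in>{0..\<sigma>}. \<psi> s base -` A)" by auto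
  ultimately show ?thesis by simp
qed

lemma period_ball_closed: "closed (period_ball R)"
  using closed_period_set[OF closed_cball[of 0 R]] by (simp add: period_ball_def)

lemma period_ball_norm: "x \<in> period_ball R \<Longrightarrow> norm x \<le> R"
  using \<sigma>_pos \<psi>_0[OF base_circle, of x] by (force simp: period_ball_def)

lemma period_ball_monodromy: "x \<in> period_ball R \<Longrightarrow> norm (monodromy x) \<le> R"
  using \<sigma>_pos by (auto simp: period_ball_def monodromy_def)

lemma period_ball_local: "\<exists>R d. 0 < d \<and> cball x d \<subseteq> period_ball R"
proof -
  obtain \<eta> where \<eta>: "0 < \<eta>" "\<And>y s. dist y x < \<eta> \<Longrightarrow> s \<in> {0..\<sigma>} \<Longrightarrow> dist (\<psi> s base y) (\<psi> s base x) < 1"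
    using period_tube[of 1 x] by auto
  have "compact ((\<lambda>s. \<psi> s base x) ` {0..\<sigma>})"
    by (intro compact_continuous_image continuous_on_subset[OF \<psi>_cont_t[OF base_circle]]) auto
  then obtain M where M: "\<And>s. s \<in> {0..\<sigma>} \<Longrightarrow> norm (\<psi> s base x) \<le> M"
    using compact_imp_bounded bounded_iff by (metis imageI)
  have "cball x (\<eta> / 2) \<subseteq> period_ball (M + 1)"
  proof
    fix y assume "y \<in> cball x (\<eta> / 2)"
    then have "dist y x < \<eta>" using \<eta>(1) by (simp add: dist_commute)
    then have "norm (\<psi> s base y) \<le> M + 1" if "s \<in> {0..\<sigma>}" for s
      using \<eta>(2)[of y s] M[of s] that norm_triangle_sub[of "\<psi> s base y" "\<psi> s base x"]
      by (simp add: dist_norm)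
    then show "y \<in> period_ball (M + 1)" by (simp add: period_ball_def)
  qed
  then show ?thesis using \<eta>(1) by (intro exI[of _ "M + 1"] exI[of _ "\<eta> / 2"]) simp
qed

lemma period_ball_history:
  assumes "\<And>j. j < n \<Longrightarrow> (monodromy ^^ j) z \<in> period_ball R" and "0 < n" "0 \<le> t" "t \<le> real n * \<sigma>"
  shows "norm (\<psi> t base z) \<le> R"
proof -
  obtain m s where ts: "t = s + real m * \<sigma>" "s \<in> {0..\<sigma>}" using period_decompose[OF assms(3)] .
  show ?thesis
  proof (cases "m < n")
    case True
    then show ?thesis
      using assms(1)[OF True] ts \<psi>_iter[of s m z] by (simp add: period_ball_def)
  next
    case False
    \<comment> \<open>Only \<open>t = real n * \<sigma>\<close> falls here. It is treated as the end
      of period \<open>n - 1\<close>, since the iterate with index \<open>n\<close> is not assumed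
      bounded.\<close>
    then have "real n * \<sigma> \<le> real m * \<sigma>" using \<sigma>_pos by simp
    then have "t = \<sigma> + real (n - 1) * \<sigma>"
      using ts assms(2,4) by (simp add: of_nat_diff algebra_simps)
    then show ?thesis
      using assms(1)[of "n - 1"] assms(2) \<psi>_iter[of \<sigma> "n - 1" z] \<sigma>_pos by (simp add: period_ball_def)
  qed
qed

text \<open>The final piece of length \<open>t\<^sub>c\<close> is split off. As the end times are
  whole numbers of periods, it starts over the same point \<open>p\<close> of the circle for every
  \<open>k\<close>, so a single compact map acts on bounded states.\<close>

lemma monodromy_compact_of_compact_cocycle:
  assumes tc: "0 < t\<^sub>c" "\<And>p. p \<in> circle \<sigma> \<Longrightarrow> compact_map (\<psi> t\<^sub>c p)"
    and n: "\<And>k. t\<^sub>c \<le> real (n k) * \<sigma>"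
    and z: "\<And>k j. j < n k \<Longrightarrow> (monodromy ^^ j) (z k) \<in> period_ball R"
  obtains r l where "strict_mono (r :: nat \<Rightarrow> nat)" "(\<lambda>k. (monodromy ^^ n (r k)) (z (r k))) \<longlonglongrightarrow> l"
proof -
  define p where "p = rotation (- t\<^sub>c) base"
  have p: "p \<in> circle \<sigma>" by (simp add: p_def rotation_in_circle base_circle)
  define x where "x k = \<psi> (real (n k) * \<sigma> - t\<^sub>c) base (z k)" for k
  have "0 < n k" for k using n[of k] tc(1) by (cases "n k") auto
  then have x: "norm (x k) \<le> R" for k
    unfolding x_def using n[of k] tc(1) by (intro period_ball_history[OF z]) auto
  obtain r l where r: "strict_mono r" "(\<lambda>k. \<psi> t\<^sub>c p (x (r k))) \<longlonglongrightarrow> l"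
    by (rule compact_map_subseq[OF tc(2)[OF p] x])
  have "\<psi> t\<^sub>c p (x k) = (monodromy ^^ n k) (z k)" for k
    using \<psi>_add[OF base_circle, of t\<^sub>c "real (n k) * \<sigma> - t\<^sub>c" "z k"] n[of k] tc(1)
      rotation_period[of "- t\<^sub>c" "n k"]
    by (simp add: x_def p_def monodromy_iter)
  then show ?thesis using that r by simp
qed

text \<open>
  If \<open>P\<close> is compact, then \<open>V\<close> tends to zero on differences of the end points along a subsequence,
  and the inequality makes the trajectories of the last period Cauchy in \<open>L\<^sup>2\<close>. They
  converge at some moment of this period, hence also at its end.
\<close>

lemma monodromy_compact_of_compact_operator:
  assumes P: "compact_map P" and n: "filterlim n at_top sequentially" and n_pos: "\<And>k. 0 < n k"
    and z: "\<And>k j. j < n k \<Longrightarrow> (monodromy ^^ j) (z k) \<in> period_ball R"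
  obtains r l where "strict_mono (r :: nat \<Rightarrow> nat)" "(\<lambda>k. (monodromy ^^ n (r k)) (z (r k))) \<longlonglongrightarrow> l"
proof -
  define y where "y k = (monodromy ^^ n k) (z k)" for k
  define x where "x k = (monodromy ^^ (n k - 1)) (z k)" for k
  have yx: "y k = monodromy (x k)" for k
    using n_pos[of k] by (cases "n k") (simp_all add: y_def x_def)
  have "x k \<in> period_ball R" for k using z[of "n k - 1" k] n_pos[of k] by (simp add: x_def)
  then have yR: "norm (y k) \<le> R" for k by (simp add: yx period_ball_monodromy)
  then have R: "0 \<le> R" using norm_ge_zero order_trans by blast
  obtain r1 a where r1: "strict_mono r1" and Pa: "(\<lambda>k. P (y (r1 k))) \<longlonglongrightarrow> a"
    by (rule compact_map_subseq[OF P yR])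
  define g where "g k s = \<psi> s base (x (r1 k))" for k s
  define C where "C = onorm P * (2 * R)\<^sup>2"
  define \<kappa> where "\<kappa> = exp (2 * \<nu> * \<sigma>)"
  have "1 < \<kappa>" using \<nu>_pos \<sigma>_pos by (simp add: \<kappa>_def)
  have C: "0 \<le> C" unfolding C_def using onorm_pos_le[OF P_lin] by simp
  \<comment> \<open>Going \<open>m\<close> periods back gains \<open>\<kappa> ^ m\<close>, and
    \<open>C\<close> bounds \<open>V\<close> on differences of points of norm at most
    \<open>R\<close>. This bounds \<open>V\<close> from above only; it may well be negative.\<close>
  have step: "\<kappa> ^ m * V (x k - x j) \<le> C" if "m < n k" "m < n j" for m k j
  proof -
    define u where "u k = (monodromy ^^ (n k - 1 - m)) (z k)" for k
    have u: "norm (u k) \<le> R" for k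
      unfolding u_def using z[of "n k - 1 - m" k] n_pos[of k] by (intro period_ball_norm) simp
    have xu: "x i = \<psi> (real m * \<sigma>) base (u i)" if "m < n i" for i
    proof -
      have "n i - 1 = m + (n i - 1 - m)" using that by simp
      then have "x i = (monodromy ^^ m) (u i)" unfolding x_def u_def by (metis comp_apply funpow_add)
      then show ?thesis by (simp add: monodromy_iter)
    qed
    have "\<kappa> ^ m = exp (2 * \<nu> * (real m * \<sigma>))"
      by (simp add: \<kappa>_def exp_of_nat_mult[symmetric] algebra_simps)
    then have "\<kappa> ^ m * V (x k - x j) \<le> V (u k - u j)"
      using V_decrease_weak[of "real m * \<sigma>" "u k" "u j"] \<sigma>_pos xu that by simp
    also have "\<dots> \<le> onorm P * (norm (u k - u j))\<^sup>2"
      using V_bound[of "u k - u j"] by simp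
    also have "\<dots> \<le> C"
      unfolding C_def using norm_triangle_ineq4[of "u k" "u j"] u[of k] u[of j]
      by (intro mult_left_mono power_mono onorm_pos_le[OF P_lin]) auto
    finally show ?thesis .
  qed
  \<comment> \<open>In the squeezing inequality over the last period the end term has the
    unfavourable sign; it is controlled by the convergence of \<open>P (y (r1 k))\<close>.\<close>
  have last: "\<delta> * integral {0..\<sigma>} (\<lambda>s. (norm (g k s - g j s))\<^sup>2)
      \<le> V (x (r1 k) - x (r1 j)) + \<kappa> * (norm (P (y (r1 k)) - P (y (r1 j))) * (2 * R))" for k j
  proof -
    let ?u = "x (r1 k)" and ?v = "x (r1 j)"
    have "integral {0..\<sigma>} (\<lambda>s. (norm (g k s - g j s))\<^sup>2) \<le> integral {0..\<sigma>} (sq_dist ?u ?v)"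
    proof (rule integral_le)
      show "(\<lambda>s. (norm (g k s - g j s))\<^sup>2) integrable_on {0..\<sigma>}"
        unfolding g_def by (intro integrable_continuous_real continuous_intros
            continuous_on_subset[OF \<psi>_cont_t[OF base_circle]]) auto
      show "sq_dist ?u ?v integrable_on {0..\<sigma>}"
        by (rule integrable_continuous_real[OF sq_dist_cont])
      show "(norm (g k s - g j s))\<^sup>2 \<le> sq_dist ?u ?v s" if "s \<in> {0..\<sigma>}" for s
        using that \<nu>_pos by (simp add: g_def mult_le_cancel_right1)
    qed
    then have "\<delta> * integral {0..\<sigma>} (\<lambda>s. (norm (g k s - g j s))\<^sup>2) \<le> \<delta> * integral {0..\<sigma>} (sq_dist ?u ?v)"
      using \<delta>_pos by simp
    also have "\<dots> \<le> V (?u - ?v) + \<kappa> * (- V (y (r1 k) - y (r1 j)))"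
      using V_decrease[of \<sigma> ?u ?v] \<sigma>_pos unfolding yx monodromy_def \<kappa>_def by simp
    also have "- V (y (r1 k) - y (r1 j)) \<le> norm (P (y (r1 k)) - P (y (r1 j))) * (2 * R)"
    proof -
      have "- V (y (r1 k) - y (r1 j)) \<le> norm (P (y (r1 k) - y (r1 j))) * norm (y (r1 k) - y (r1 j))"
        unfolding V_def quadratic_form_def
        using Cauchy_Schwarz_ineq2[of "P (y (r1 k) - y (r1 j))" "y (r1 k) - y (r1 j)"] by linarith
      also have "norm (y (r1 k) - y (r1 j)) \<le> 2 * R"
        using norm_triangle_ineq4[of "y (r1 k)" "y (r1 j)"] yR[of "r1 k"] yR[of "r1 j"] by simp
      also have "P (y (r1 k) - y (r1 j)) = P (y (r1 k)) - P (y (r1 j))"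
        using bounded_linear.linear[OF P_lin] by (simp add: linear_diff)
      finally show ?thesis by (simp add: mult_left_mono)
    qed
    finally show ?thesis using \<open>1 < \<kappa>\<close> by simp
  qed
  have Cauchy: "\<exists>N. \<forall>k\<ge>N. \<forall>j\<ge>N. integral {0..\<sigma>} (\<lambda>s. (norm (g k s - g j s))\<^sup>2) < \<epsilon>" if "0 < \<epsilon>" for \<epsilon>
  proof -
    define d where "d = \<delta> * \<epsilon> / 3"
    have d: "0 < d" using \<delta>_pos that by (simp add: d_def)
    obtain m where m: "C / d < \<kappa> ^ m" using real_arch_pow[OF \<open>1 < \<kappa>\<close>] by blast
    have "\<forall>\<^sub>F k in sequentially. m < n (r1 k)"
      using filterlim_compose[OF n filterlim_subseq[OF r1]]
      unfolding filterlim_at_top Suc_le_eq[symmetric] by blast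
    then obtain N1 where N1: "\<And>k. N1 \<le> k \<Longrightarrow> m < n (r1 k)" by (auto simp: eventually_sequentially)
    \<comment> \<open>Using \<open>2 * R + 1\<close> instead of \<open>2 * R\<close> keeps the
      divisor positive when \<open>R = 0\<close>.\<close>
    have "0 < d / (\<kappa> * (2 * R + 1))" using d R \<open>1 < \<kappa>\<close> by simp
    then obtain N2 where N2: "\<And>k j. N2 \<le> k \<Longrightarrow> N2 \<le> j \<Longrightarrow>
        norm (P (y (r1 k)) - P (y (r1 j))) < d / (\<kappa> * (2 * R + 1))"
      using CauchyD[OF LIMSEQ_imp_Cauchy[OF Pa]] by meson
    have "integral {0..\<sigma>} (\<lambda>s. (norm (g k s - g j s))\<^sup>2) < \<epsilon>" if "max N1 N2 \<le> k" "max N1 N2 \<le> j" for k j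
    proof -
      have "\<kappa> ^ m * V (x (r1 k) - x (r1 j)) \<le> C" using step N1 that by simp
      also have "C \<le> \<kappa> ^ m * d" using m d by (simp add: field_simps)
      finally have 1: "V (x (r1 k) - x (r1 j)) \<le> d" using \<open>1 < \<kappa>\<close> by simp
      have "norm (P (y (r1 k)) - P (y (r1 j))) * (\<kappa> * (2 * R + 1)) < d"
        using N2[of k j] that R \<open>1 < \<kappa>\<close> by (simp add: pos_less_divide_eq)
      moreover have "norm (P (y (r1 k)) - P (y (r1 j))) * (\<kappa> * (2 * R)) \<le> norm (P (y (r1 k)) - P (y (r1 j))) * (\<kappa> * (2 * R + 1))"
        using \<open>1 < \<kappa>\<close> by (intro mult_left_mono) auto
      ultimately have "\<kappa> * (norm (P (y (r1 k)) - P (y (r1 j))) * (2 * R)) \<le> d" by (simp add: mult_ac)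
      with 1 last[of k j] have "\<delta> * integral {0..\<sigma>} (\<lambda>s. (norm (g k s - g j s))\<^sup>2) \<le> 2 * d" by simp
      also have "\<dots> < \<delta> * \<epsilon>" using d by (simp add: d_def)
      finally show ?thesis using \<delta>_pos by simp
    qed
    then show ?thesis by (metis max.bounded_iff)
  qed
  have "continuous_on {0..\<sigma>} (g k)" for k
    unfolding g_def by (intro continuous_on_subset[OF \<psi>_cont_t[OF base_circle]]) auto
  then obtain s r2 where s: "s \<in> {0..\<sigma>}" and r2: "strict_mono r2" and "convergent (\<lambda>i. g (r2 i) s)"
    using L2_Cauchy_imp_pointwise_convergent[OF \<sigma>_pos _ Cauchy] by blast
  then obtain l where l: "(\<lambda>i. g (r2 i) s) \<longlonglongrightarrow> l" by (auto simp: convergent_def)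
  have "(\<lambda>i. \<psi> (\<sigma> - s) (rotation s base) (g (r2 i) s)) \<longlonglongrightarrow> \<psi> (\<sigma> - s) (rotation s base) l"
    using s by (intro \<psi>_tendsto l rotation_in_circle base_circle) simp
  moreover have "\<psi> (\<sigma> - s) (rotation s base) (g k s) = y (r1 k)" for k
    using \<psi>_add[OF base_circle, of "\<sigma> - s" s] s by (simp add: g_def yx monodromy_def)
  ultimately show ?thesis
    using that[of "r1 \<circ> r2"] strict_mono_o[OF r1 r2] by (simp add: y_def)
qed

text \<open>Both cases want \<open>n k\<close> large for every \<open>k\<close>; this holds after
  dropping finitely many indices, and \<open>shift\<close> restores the numbering.\<close>

lemma monodromy_compact:
  assumes n: "filterlim n at_top sequentially"
    and z: "\<And>k j. j < n k \<Longrightarrow> (monodromy ^^ j) (z k) \<in> period_ball R"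
  shows "\<exists>r l. strict_mono r \<and> (\<lambda>k. (monodromy ^^ n (r k)) (z (r k))) \<longlonglongrightarrow> l"
proof -
  have shift: "\<exists>r l. strict_mono r \<and> (\<lambda>k. (monodromy ^^ n (r k)) (z (r k))) \<longlonglongrightarrow> l"
    if "strict_mono r" "(\<lambda>k. (monodromy ^^ n (r k + K)) (z (r k + K))) \<longlonglongrightarrow> l" for r :: "nat \<Rightarrow> nat" and K l
    using that by (intro exI[of _ "\<lambda>k. r k + K"] exI[of _ l]) (simp add: strict_mono_def)
  have nK: "filterlim (\<lambda>k. n (k + K)) at_top sequentially" for K
    by (rule filterlim_compose[OF n filterlim_add_const_nat_at_top])
  show ?thesis
    using compactness
  proof
    assume P: "compact_map P"
    have "\<forall>\<^sub>F k in sequentially. Suc 0 \<le> n k" using n unfolding filterlim_at_top by blast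
    then obtain K where K: "\<And>k. K \<le> k \<Longrightarrow> 0 < n k" by (auto simp: eventually_sequentially Suc_le_eq)
    obtain r l where "strict_mono r" "(\<lambda>k. (monodromy ^^ n (r k + K)) (z (r k + K))) \<longlonglongrightarrow> l"
      by (rule monodromy_compact_of_compact_operator[OF P nK[of K], of "\<lambda>k. z (k + K)" R])
        (use K z in auto)
    then show ?thesis by (rule shift)
  next
    assume "\<exists>t\<^sub>c>0. \<forall>q\<in>circle \<sigma>. compact_map (\<psi> t\<^sub>c q)"
    then obtain t\<^sub>c where tc: "0 < t\<^sub>c" "\<And>p. p \<in> circle \<sigma> \<Longrightarrow> compact_map (\<psi> t\<^sub>c p)" by blast
    have "\<forall>\<^sub>F k in sequentially. nat \<lceil>t\<^sub>c / \<sigma>\<rceil> \<le> n k" using n unfolding filterlim_at_top by blast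
    then obtain K where "\<And>k. K \<le> k \<Longrightarrow> nat \<lceil>t\<^sub>c / \<sigma>\<rceil> \<le> n k" by (auto simp: eventually_sequentially)
    then have K: "t\<^sub>c \<le> real (n (k + K)) * \<sigma>" for k
      using \<sigma>_pos by (simp add: pos_divide_le_eq[symmetric] nat_ceiling_le_eq)
    obtain r l where "strict_mono r" "(\<lambda>k. (monodromy ^^ n (r k + K)) (z (r k + K))) \<longlonglongrightarrow> l"
      by (rule monodromy_compact_of_compact_cocycle[of t\<^sub>c "\<lambda>k. n (k + K)" "\<lambda>k. z (k + K)" R])
        (use K z tc in auto)
    then show ?thesis by (rule shift)
  qed
qed

text \<open>The contraction factor is the growth of the weight in the squeezing inequality over one
  period.\<close>

lemma monodromy_cone_system:
  "cone_system monodromy V (\<lambda>x. x \<bullet> e) (exp (2 * \<nu> * \<sigma>)) (onorm P) period_ball G period_sink"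
proof (rule cone_system.intro)
  show "continuous_on UNIV monodromy"
    unfolding monodromy_def using \<psi>_cont_u[OF base_circle] \<sigma>_pos by simp
  show "bounded_linear (\<lambda>x. x \<bullet> e)" by (rule bounded_linear_inner_left)
  show "continuous_on UNIV V" by (rule V_cont)
  show "V (- x) = V x" "\<bar>V x\<bar> \<le> onorm P * (norm x)\<^sup>2" for x by (rule V_minus, rule V_bound)
  show "x = 0" if "V x \<le> 0" "x \<bullet> e = 0" for x using P_ker that by (simp add: V_def)
  show "1 < exp (2 * \<nu> * \<sigma>)" using \<nu>_pos \<sigma>_pos by simp
  show "exp (2 * \<nu> * \<sigma>) * V (monodromy u - monodromy v) < V (u - v)" if "u \<noteq> v" for u v
    unfolding monodromy_def using V_decrease_strict[OF \<sigma>_pos that] .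
  show "monodromy u \<bullet> e < monodromy v \<bullet> e" if "V (u - v) \<le> 0" "u \<bullet> e < v \<bullet> e" for u v
    using monodromy_mono[OF that] .
  show "period_ball R \<subseteq> period_ball R'" if "R \<le> R'" for R R'
    using that by (force simp: period_ball_def)
  show "closed (period_ball R)" for R by (rule period_ball_closed)
  show "norm x \<le> R" if "x \<in> period_ball R" for x R using period_ball_norm[OF that] .
  show "\<exists>R d. 0 < d \<and> cball x d \<subseteq> period_ball R" for x by (rule period_ball_local)
  show "\<exists>r l. strict_mono r \<and> (\<lambda>k. (monodromy ^^ n (r k)) (z (r k))) \<longlonglongrightarrow> l"
    if "filterlim n at_top sequentially" "\<And>k j. j < n k \<Longrightarrow> (monodromy ^^ j) (z k) \<in> period_ball R" for n z R
    using monodromy_compact[OF that] .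
  show "closed period_sink"
    unfolding period_sink_def by (rule closed_period_set[OF S0_closed])
  show "period_sink \<subseteq> G"
    using S0_G \<sigma>_pos \<psi>_0[OF base_circle] by (force simp: period_sink_def)
  obtain M where "\<And>x. x \<in> S\<^sub>0 \<Longrightarrow> norm x \<le> M" using S0_bounded bounded_iff by metis
  then show "\<exists>R. period_sink \<subseteq> period_ball R"
    by (intro exI[of _ M]) (auto simp: period_sink_def period_ball_def)
  show "open G" by (rule G_open)
  show "G \<noteq> {}" using S0_ne S0_G by blast
  show "\<forall>\<^sub>F n in sequentially. (monodromy ^^ n) u \<in> period_sink" if u: "u \<in> G" for u
  proof -
    obtain T where T: "\<And>t. T \<le> t \<Longrightarrow> \<psi> t base u \<in> S\<^sub>0"
      using G_attracted[OF u base_circle] by blast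
    have "\<forall>\<^sub>F n in sequentially. T / \<sigma> \<le> real n"
      using filterlim_real_sequentially unfolding filterlim_at_top by blast
    then show ?thesis
    proof eventually_elim
      case (elim n)
      have "\<psi> s base ((monodromy ^^ n) u) \<in> S\<^sub>0" if "s \<in> {0..\<sigma>}" for s
      proof -
        have "T \<le> s + real n * \<sigma>" using elim that \<sigma>_pos by (simp add: pos_divide_le_eq)
        then show ?thesis using T[of "s + real n * \<sigma>"] \<psi>_iter[of s n u] that by simp
      qed
      then show ?case by (simp add: period_sink_def)
    qed
  qed
qed

text \<open>Negative times cannot be reached by running the cocycle backwards, so the time is moved
  up by the least number of periods making it nonnegative; for \<open>t \<ge> 0\<close> this number
  is 0.\<close>

definition periodic_extension :: "'h \<Rightarrow> real \<Rightarrow> 'h" where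
  "periodic_extension p t = \<psi> (t + real (nat \<lceil>- t / \<sigma>\<rceil>) * \<sigma>) base p"

lemma fixpt_iter: "monodromy p = p \<Longrightarrow> 0 \<le> t \<Longrightarrow> \<psi> (t + real n * \<sigma>) base p = \<psi> t base p"
proof -
  assume p: "monodromy p = p" and t: "0 \<le> t"
  have "(monodromy ^^ n) p = p" by (induction n) (simp_all add: p)
  then show ?thesis using \<psi>_iter[OF t] by simp
qed

text \<open>The number of added periods is immaterial at a fixed point. A single \<open>n\<close>
  may thus be used near a given time, where the ceiling would jump.\<close>

lemma periodic_extension_eq:
  assumes p: "monodromy p = p" and t: "0 \<le> t + real n * \<sigma>"
  shows "periodic_extension p t = \<psi> (t + real n * \<sigma>) base p"
proof -
  define m where "m = nat \<lceil>- t / \<sigma>\<rceil>"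
  have "- t / \<sigma> \<le> real m" unfolding m_def by linarith
  then have m: "0 \<le> t + real m * \<sigma>" using \<sigma>_pos by (simp add: field_simps)
  have "- t / \<sigma> \<le> real n" using t \<sigma>_pos by (simp add: field_simps)
  then have "m \<le> n" unfolding m_def by linarith
  then have "t + real n * \<sigma> = (t + real m * \<sigma>) + real (n - m) * \<sigma>"
    by (simp add: of_nat_diff algebra_simps)
  then show ?thesis
    unfolding periodic_extension_def m_def[symmetric] using fixpt_iter[OF p m, of "n - m"] by (simp only:)
qed

lemma shift_nonneg: obtains n where "0 \<le> t + real n * \<sigma>"
proof -
  obtain n where "- t / \<sigma> \<le> real n" using real_arch_simple by blast
  then have "0 \<le> t + real n * \<sigma>" using \<sigma>_pos by (simp add: field_simps)
  then show ?thesis by (rule that)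
qed

lemma periodic_extension_trajectory:
  assumes p: "monodromy p = p"
  shows "periodic_trajectory \<sigma> rotation \<psi> base (periodic_extension p)"
proof -
  have "isCont (periodic_extension p) t" for t
  proof -
    \<comment> \<open>Taking \<open>t - 1\<close> instead of \<open>t\<close> makes one formula
      valid on a neighbourhood of \<open>t\<close>.\<close>
    obtain n where n: "0 \<le> (t - 1) + real n * \<sigma>" using shift_nonneg .
    have "continuous_on {t - 1<..} (\<lambda>t. \<psi> (t + real n * \<sigma>) base p)"
      by (rule continuous_on_compose2[OF \<psi>_cont_t[OF base_circle]])
        (use n in \<open>auto intro!: continuous_intros\<close>)
    then have "continuous_on {t - 1<..} (periodic_extension p)"
      by (rule continuous_on_eq) (use n periodic_extension_eq[OF p, of _ n] in auto)
    then show ?thesis by (simp add: continuous_on_eq_continuous_at)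
  qed
  then have "continuous_on UNIV (periodic_extension p)"
    by (simp add: continuous_on_eq_continuous_at)
  moreover have "periodic_extension p (t + s) = \<psi> t (rotation s base) (periodic_extension p s)" if "0 \<le> t" for t s
  proof -
    obtain n where n: "0 \<le> s + real n * \<sigma>" using shift_nonneg .
    have "periodic_extension p (t + s) = \<psi> (t + (s + real n * \<sigma>)) base p"
      using periodic_extension_eq[OF p, of "t + s" n] n that by (simp add: add.assoc)
    also have "\<dots> = \<psi> t (rotation s base) (\<psi> (s + real n * \<sigma>) base p)"
      using \<psi>_add[OF base_circle that n] by (simp add: rotation_period)
    finally show ?thesis using periodic_extension_eq[OF p n] by simp
  qed
  moreover have "periodic_extension p (t + \<sigma>) = periodic_extension p t" for t
  proof -
    obtain n where n: "0 \<le> t + real n * \<sigma>" using shift_nonneg .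
    then show ?thesis
      using periodic_extension_eq[OF p, of "t + \<sigma>" n] periodic_extension_eq[OF p, of t "Suc n"] \<sigma>_pos
      by (simp add: algebra_simps)
  qed
  ultimately show ?thesis
    by (simp add: periodic_trajectory_def complete_trajectory_def)
qed

lemma exists_stable_periodic_trajectory:
  "\<exists>q\<in>circle \<sigma>. \<exists>v. periodic_trajectory \<sigma> rotation \<psi> q v \<and> lyapunov_stable \<psi> q v \<and> (\<forall>t. v t \<in> S\<^sub>0)"
proof -
  interpret cone_system monodromy V "\<lambda>x. x \<bullet> e" "exp (2 * \<nu> * \<sigma>)" "onorm P" period_ball G period_sink
    by (rule monodromy_cone_system)
  obtain p where p: "p \<in> period_sink" "monodromy p = p"
    and stable: "\<And>\<epsilon>. 0 < \<epsilon> \<Longrightarrow> \<exists>\<eta>>0. \<forall>u. dist u p < \<eta> \<longrightarrow> (\<forall>n. dist ((monodromy ^^ n) u) p < \<epsilon>)"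
    using exists_stable_fixpt by blast
  let ?v = "periodic_extension p"
  have v: "?v t = \<psi> t base p" if "0 \<le> t" for t
    using periodic_extension_eq[OF p(2), of t 0] that by simp
  have "lyapunov_stable \<psi> base ?v"
    unfolding lyapunov_stable_def
  proof (intro allI impI)
    fix \<epsilon> :: real assume "0 < \<epsilon>"
    \<comment> \<open>\<open>\<eta>'\<close> controls the deviation within one period, and
      \<open>\<eta>\<close> keeps all iterates within \<open>\<eta>'\<close> of
      \<open>p\<close>.\<close>
    then obtain \<eta>' where \<eta>': "0 < \<eta>'" "\<And>x s. dist x p < \<eta>' \<Longrightarrow> s \<in> {0..\<sigma>} \<Longrightarrow> dist (\<psi> s base x) (\<psi> s base p) < \<epsilon>"
      using period_tube[of \<epsilon> p] by blast
    obtain \<eta> where \<eta>: "0 < \<eta>" "\<And>u n. dist u p < \<eta> \<Longrightarrow> dist ((monodromy ^^ n) u) p < \<eta>'"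
      using stable[OF \<eta>'(1)] by blast
    have "norm (\<psi> t base u - ?v t) < \<epsilon>" if u: "norm (\<psi> 0 base u - ?v 0) < \<eta>" and t: "0 \<le> t" for u t
    proof -
      obtain n s where ts: "t = s + real n * \<sigma>" "s \<in> {0..\<sigma>}" using period_decompose[OF t] .
      have "dist u p < \<eta>" using u by (simp add: v dist_norm \<psi>_0 base_circle)
      then have "dist (\<psi> s base ((monodromy ^^ n) u)) (\<psi> s base p) < \<epsilon>"
        using \<eta>(2) \<eta>'(2) ts(2) by blast
      then show ?thesis
        using ts v[OF t] \<psi>_iter[of s n u] fixpt_iter[OF p(2), of s n] by (simp add: dist_norm)
    qed
    then show "\<exists>\<eta>>0. \<forall>u. norm (\<psi> 0 base u - ?v 0) < \<eta> \<longrightarrow> (\<forall>t\<ge>0. norm (\<psi> t base u - ?v t) < \<epsilon>)"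
      using \<eta>(1) by blast
  qed
  moreover have "?v t \<in> S\<^sub>0" for t
  proof -
    obtain n where n: "0 \<le> t + real n * \<sigma>" using shift_nonneg .
    obtain m s where ts: "t + real n * \<sigma> = s + real m * \<sigma>" "s \<in> {0..\<sigma>}"
      using period_decompose[OF n] .
    then have "?v t = \<psi> s base p"
      using periodic_extension_eq[OF p(2) n] fixpt_iter[OF p(2), of s m] by simp
    then show ?thesis using p(1) ts(2) by (simp add: period_sink_def)
  qed
  ultimately show ?thesis
    using base_circle periodic_extension_trajectory[OF p(2)] by blast
qed

end

section \<open>From the orthogonal splitting to a single direction\<close>

lemma dim_1_subspace_span:
  fixes E :: "'a::real_vector set"
  assumes "subspace E" "dim E = 1"
  obtains e where "e \<noteq> 0" "E = span {e}"
proof -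
  obtain B where B: "B \<subseteq> E" "independent B" "E \<subseteq> span B" "card B = dim E"
    using basis_exists[of E] by blast
  then obtain e where e: "B = {e}" using assms(2) card_1_singletonE by metis
  then have "e \<noteq> 0" using B(2) dependent_zero by blast
  moreover have "E = span {e}" using B e assms(1) span_minimal by blast
  ultimately show ?thesis using that by blast
qed

text \<open>Orthogonality to \<open>e\<close> removes the component in \<open>Hm\<close>; what
  remains lies in \<open>Hp\<close>, where the form is positive.\<close>

lemma quadratic_form_orthogonal_kernel:
  assumes P: "linear P" and sum: "orthogonal_direct_sum Hp Hm"
    and pos: "positive_on P Hp" and Hm: "Hm = span {e}"
    and V: "quadratic_form P x \<le> 0" and xe: "x \<bullet> e = 0"
  shows "x = 0"
proof -
  obtain y z where x: "x = y + z" and y: "y \<in> Hp" and z: "z \<in> Hm"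
    using sum unfolding orthogonal_direct_sum_def by blast
  have orth: "y \<bullet> w = 0" if "w \<in> Hm" for w
    using sum y that unfolding orthogonal_direct_sum_def orthogonal_def by blast
  obtain c where c: "z = c *\<^sub>R e" using z Hm by (auto simp: span_singleton)
  have "e \<in> Hm" using Hm by (simp add: span_base)
  then have "z \<bullet> e = 0" using xe orth by (simp add: x inner_add_left)
  then have "z = 0" using c by auto
  then have "x = y" using x by simp
  then show ?thesis using V pos y unfolding positive_on_def quadratic_form_def by fastforce
qed

theorem theorem3:
  fixes \<sigma> :: real
    and \<psi> :: "real \<Rightarrow> real set \<Rightarrow> 'h \<Rightarrow> 'h::{real_inner, complete_space}"
    and P :: "'h \<Rightarrow> 'h"
    and Hp Hm S\<^sub>0 :: "'h set"
  assumes "separable_space (euclidean :: 'h topology)"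
    and "\<sigma> > 0"
    and "periodic_cocycle \<sigma> \<psi>"
    and "bounded_linear P" and "self_adjoint P"
    and "orthogonal_direct_sum Hp Hm"
    and "P ` Hp \<subseteq> Hp" and "P ` Hm \<subseteq> Hm"
    and "negative_on P Hm" and "positive_on P Hp"
    and "dim Hm = 1"
    and "\<exists>\<delta>>0. \<exists>\<nu>>0. \<forall>u v. \<forall>q\<in>circle \<sigma>. \<forall>l r. 0 \<le> l \<and> l \<le> r \<longrightarrow>
           exp (2 * \<nu> * r) * quadratic_form P (\<psi> r q u - \<psi> r q v)
             - exp (2 * \<nu> * l) * quadratic_form P (\<psi> l q u - \<psi> l q v)
           \<le> - \<delta> * integral {l..r} (\<lambda>s. exp (2 * \<nu> * s) * (norm (\<psi> s q u - \<psi> s q v))\<^sup>2)"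
    and "compact_map P \<or> (\<exists>t\<^sub>c>0. \<forall>q\<in>circle \<sigma>. compact_map (\<psi> t\<^sub>c q))"
    and "S\<^sub>0 \<noteq> {}"
    and "sink (circle \<sigma>) \<psi> S\<^sub>0"
  shows "\<exists>q\<in>circle \<sigma>. \<exists>v. periodic_trajectory \<sigma> rotation \<psi> q v \<and> lyapunov_stable \<psi> q v \<and>
           (\<forall>t. v t \<in> S\<^sub>0)"
proof -
  obtain \<delta> \<nu> where \<delta>: "0 < \<delta>" and \<nu>: "0 < \<nu>" and squeeze: "\<forall>u v. \<forall>q\<in>circle \<sigma>. \<forall>l r. 0 \<le> l \<and> l \<le> r \<longrightarrow>
      exp (2 * \<nu> * r) * quadratic_form P (\<psi> r q u - \<psi> r q v)
        - exp (2 * \<nu> * l) * quadratic_form P (\<psi> l q u - \<psi> l q v)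
      \<le> - \<delta> * integral {l..r} (\<lambda>s. exp (2 * \<nu> * s) * (norm (\<psi> s q u - \<psi> s q v))\<^sup>2)"
    using assms(12) by (elim exE conjE)
  obtain G where sink: "bounded S\<^sub>0" "closed S\<^sub>0" "open G" "S\<^sub>0 \<subseteq> G"
    and attracted: "\<forall>u\<in>G. \<forall>q\<in>circle \<sigma>. \<exists>T\<ge>0. \<forall>t\<ge>T. \<psi> t q u \<in> S\<^sub>0"
    using assms(15) unfolding sink_def by blast
  have "subspace Hm" using assms(6) by (simp add: orthogonal_direct_sum_def)
  then obtain e where e: "Hm = span {e}"
    using dim_1_subspace_span assms(11) by blast
  interpret squeezing_cocycle \<sigma> \<psi> P e \<delta> \<nu> G S\<^sub>0
  proof (rule squeezing_cocycle.intro)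
    show "x = 0" if "quadratic_form P x \<le> 0" "x \<bullet> e = 0" for x
      by (rule quadratic_form_orthogonal_kernel[OF bounded_linear.linear[OF assms(4)] assms(6,10) e that])
    show "exp (2 * \<nu> * r) * quadratic_form P (\<psi> r q u - \<psi> r q v)
        - exp (2 * \<nu> * l) * quadratic_form P (\<psi> l q u - \<psi> l q v)
      \<le> - \<delta> * integral {l..r} (\<lambda>s. exp (2 * \<nu> * s) * (norm (\<psi> s q u - \<psi> s q v))\<^sup>2)"
      if "q \<in> circle \<sigma>" "0 \<le> l" "l \<le> r" for q l r u v
      using squeeze that by blast
    show "\<exists>T\<ge>0. \<forall>t\<ge>T. \<psi> t q u \<in> S\<^sub>0" if "u \<in> G" "q \<in> circle \<sigma>" for u q
      using attracted that by blast
  qed (fact assms(2-4,13,14) \<delta> \<nu> sink)+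
  show ?thesis by (rule exists_stable_periodic_trajectory)
qed

end
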